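(* Let $M$ be a non-horizontal submanifold of codimension $p$ of a stratified Lie group $\mathbb G$ of dimension $n$, let $\mu$ be the measure on $M$ with density $d\mu=|\tau_M^d|\,\mathrm{vol}_h\llcorner M$, and let $f_1,\dots,f_n$ be an adapted basis to $M$ (on an open set $U$ meeting $M$) with dual coframe $f^1,\dots,f^n$. Then, on $M\cap U$ (up to the choice of orientation), $$d\mu=f^{p+1}\wedge\cdots\wedge f^n.$$
   Context: Stratified group: $\mathbb G$ is a connected, simply connected nilpotent Lie group of dimension $n$ whose Lie algebra (of left-invariant vector fields) is $\mathfrak g=\mathfrak g^1\oplus\cdots\oplus\mathfrak g^r$ with $[\mathfrak g^1,\mathfrak g^j]=\mathfrak g^{j+1}$ for $1\le j\le r-1$ and $[\mathfrak g^j,\mathfrak g^r]=0$ for all $j$. Put $d_j=\dim\mathfrak g^j$. $D\subset T\mathbb G$ is the left-invariant distribution spanned by $\mathfrak g^1$, with a left-invariant scalar product $\langle\cdot,\cdot\rangle$. It is extended to $\mathfrak g$ (and left-invariantly to a Riemannian metric $h=\langle\cdot,\cdot\rangle$ on $T\mathbb G$) by declaring the $\mathfrak g^j$ mutually orthogonal and, inductively, requiring that the bracket map $B:\mathfrak g^1\otimes\mathfrak g^k\to\mathfrak g^{k+1}$, $B(X\otimes Y)=[X,Y]$, restrict to an isometry $(\ker B)^\perp\to\mathfrak g^{k+1}$. Fix an orthonormal basis $e_1,\dots,e_n$ of $\mathfrak g$ adapted to the stratification, with dual basis $e^1,\dots,e^n$; $\deg e_k=j$ if $e_k\in\mathfrak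 g^j$, and the degree of $e_{k_1}\wedge\cdots\wedge e_{k_s}$ is the sum of the degrees of the factors. $M\subset\mathbb G$ is non-horizontal if $TM+D=T\mathbb G$ along $M$. $TM^\perp$ denotes the orthogonal complement of $TM\cap D$ inside $D$. Adapted basis: a frame $f_1,\dots,f_n$ on $U$ with $f_1,\dots,f_{d_1}$ an orthonormal frame of $D$, such that along $M$ the fields $f_1,\dots,f_p$ span $TM^\perp$, $f_{p+1},\dots,f_{d_1}$ span $TM\cap D$, and for $j>d_1$ one has $f_j=e_j-\sum_{\alpha=1}^pA_j^\alpha f_\alpha$ with functions $A_j^\alpha$ such that $f_j$ is tangent to $M$. The measure $\mu$: $Q=\sum_j j\,d_j$ is the Hausdorff dimension of $\mathbb G$ and $d=Q-p$. $\tau_M(x)$ is a unit (with respect to $h$) tangent $(n-p)$-vector of $M$ at $x$, and $\tau_M^d(x)$ is its component of degree $d$ (the maximal degree) in terms of the basis of $(n-p)$-vectors $e_{k_1}\wedge\cdots\wedge e_{k_{n-p}}$. $|\cdot|$ is the norm induced by $h$. $\mathrm{vol}_h\llcorner M=(v\lrcorner\, d\mathrm{vol}_h)|_M$ is the Riemannian volume form induced on $M$ by $h$, where $d\mathrm{vol}_h=e^1\wedge\cdots\wedge e^n$, $\lrcorner$ is contraction, and $v=v_1\wedge\cdots\wedge v_p$ with $v_1,\dots,v_p$ a local $h$-orthonormal frame of the $h$-orthogonal complement of $TM$ in $T\mathbb G$. *)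

theory Defs
  imports
    "HOL-Analysis.Analysis"
    "HOL-Algebra.Group"
    "HOL-Library.Function_Algebras"
    "Jordan_Normal_Form.Determinant"
begin

section \<open>Smooth manifolds through atlases\<close>

fun Ck_on :: "nat \<Rightarrow> 'a::real_normed_vector set \<Rightarrow> ('a \<Rightarrow> 'b::real_normed_vector) \<Rightarrow> bool" where
  "Ck_on 0 S F \<longleftrightarrow> continuous_on S F"
| "Ck_on (Suc k) S F \<longleftrightarrow>
     (\<forall>u\<in>S. F differentiable (at u)) \<and> (\<forall>v. Ck_on k S (\<lambda>u. frechet_derivative F (at u) v))"

text \<open>Only meant for open sets \<open>S\<close>.\<close>

definition smooth_on :: "'a::real_normed_vector set \<Rightarrow> ('a \<Rightarrow> 'b::real_normed_vector) \<Rightarrow> bool" where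
  "smooth_on S F \<longleftrightarrow> (\<forall>k. Ck_on k S F)"

type_synonym ('g, 'a) chart = "'g set \<times> ('g \<Rightarrow> 'a)"

definition chart_inv :: "('g, 'a) chart \<Rightarrow> 'a \<Rightarrow> 'g" where
  "chart_inv c = inv_into (fst c) (snd c)"

definition smooth_atlas :: "('g::topological_space, 'a::euclidean_space) chart set \<Rightarrow> bool" where
  "smooth_atlas A \<longleftrightarrow>
     (\<forall>c\<in>A. open (fst c) \<and> open (snd c ` fst c) \<and>
        homeomorphism (fst c) (snd c ` fst c) (snd c) (chart_inv c)) \<and>
     \<Union>(fst ` A) = UNIV \<and>
     (\<forall>c\<in>A. \<forall>c'\<in>A. smooth_on (snd c ` (fst c \<inter> fst c')) (snd c' \<circ> chart_inv c))"

definition prod_atlas ::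
  "('g, 'a) chart set \<Rightarrow> ('h, 'b) chart set \<Rightarrow> ('g \<times> 'h, 'a \<times> 'b) chart set" where
  "prod_atlas A B = {(fst c \<times> fst d, map_prod (snd c) (snd d)) | c d. c \<in> A \<and> d \<in> B}"

definition smooth_map ::
  "('g::topological_space, 'a::real_normed_vector) chart set \<Rightarrow>
   ('h::topological_space, 'b::real_normed_vector) chart set \<Rightarrow> ('g \<Rightarrow> 'h) \<Rightarrow> bool" where
  "smooth_map A B F \<longleftrightarrow>
     continuous_on UNIV F \<and>
     (\<forall>c\<in>A. \<forall>d\<in>B. smooth_on (snd c ` (fst c \<inter> F -` fst d)) (snd d \<circ> F \<circ> chart_inv c))"

text \<open>
  The tangent space at a point \<open>x\<close> is represented by the model space \<open>'a\<close>, by means of one fixed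
  chart of the atlas around \<open>x\<close>. A vector field is thus a function \<open>'g \<Rightarrow> 'a\<close>.
  The maps \<open>to_chart A c x\<close> and \<open>from_chart A c x\<close> convert between this representation
  and the components in another chart \<open>c\<close> around \<open>x\<close> (not necessarily a member of \<open>A\<close>).
\<close>

definition base_chart :: "('g, 'a) chart set \<Rightarrow> 'g \<Rightarrow> ('g, 'a) chart" where
  "base_chart A x = (SOME c. c \<in> A \<and> x \<in> fst c)"

definition to_chart ::
  "('g, 'a::real_normed_vector) chart set \<Rightarrow> ('g, 'a) chart \<Rightarrow> 'g \<Rightarrow> 'a \<Rightarrow> 'a" where
  "to_chart A c x =
     frechet_derivative (snd c \<circ> chart_inv (base_chart A x)) (at (snd (base_chart A x) x))"

definition from_chart ::
  "('g, 'a::real_normed_vector) chart set \<Rightarrow> ('g, 'a) chart \<Rightarrow> 'g \<Rightarrow> 'a \<Rightarrow> 'a" where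
  "from_chart A c x = frechet_derivative (snd (base_chart A x) \<circ> chart_inv c) (at (snd c x))"

definition tangent_map ::
  "('g, 'a::real_normed_vector) chart set \<Rightarrow> ('g \<Rightarrow> 'g) \<Rightarrow> 'g \<Rightarrow> 'a \<Rightarrow> 'a" where
  "tangent_map A F x =
     frechet_derivative (snd (base_chart A (F x)) \<circ> F \<circ> chart_inv (base_chart A x))
       (at (snd (base_chart A x) x))"

definition field_in_chart ::
  "('g, 'a::real_normed_vector) chart set \<Rightarrow> ('g, 'a) chart \<Rightarrow> ('g \<Rightarrow> 'a) \<Rightarrow> 'a \<Rightarrow> 'a" where
  "field_in_chart A c X u = to_chart A c (chart_inv c u) (X (chart_inv c u))"

definition smooth_field ::
  "('g, 'a::real_normed_vector) chart set \<Rightarrow> 'g set \<Rightarrow> ('g \<Rightarrow> 'a) \<Rightarrow> bool" where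
  "smooth_field A W X \<longleftrightarrow> (\<forall>c\<in>A. smooth_on (snd c ` (fst c \<inter> W)) (field_in_chart A c X))"

definition continuous_field ::
  "('g::topological_space, 'a::real_normed_vector) chart set \<Rightarrow> 'g set \<Rightarrow> ('g \<Rightarrow> 'a) \<Rightarrow> bool" where
  "continuous_field A S X \<longleftrightarrow>
     (\<forall>c\<in>A. continuous_on (fst c \<inter> S) (\<lambda>x. to_chart A c x (X x)))"

definition lie_bracket ::
  "('g, 'a::real_normed_vector) chart set \<Rightarrow> ('g \<Rightarrow> 'a) \<Rightarrow> ('g \<Rightarrow> 'a) \<Rightarrow> 'g \<Rightarrow> 'a" where
  "lie_bracket A X Y x =
     (let c = base_chart A x; u = snd c x;
          X' = field_in_chart A c X; Y' = field_in_chart A c Y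
      in frechet_derivative Y' (at u) (X' u) - frechet_derivative X' (at u) (Y' u))"


section \<open>The real vector space of vector fields\<close>

definition field_scale :: "real \<Rightarrow> ('g \<Rightarrow> 'a::real_vector) \<Rightarrow> 'g \<Rightarrow> 'a" where
  "field_scale t X = (\<lambda>x. t *\<^sub>R X x)"

global_interpretation field_space: vector_space field_scale
  by unfold_locales (auto simp: field_scale_def fun_eq_iff algebra_simps)


section \<open>Stratified Lie groups\<close>

record ('g, 'a) stratified = "'g monoid" +
  atlas :: "('g, 'a) chart set"
  step :: nat
  layer :: "nat \<Rightarrow> ('g \<Rightarrow> 'a) set"
  sprod :: "('g \<Rightarrow> 'a) \<Rightarrow> ('g \<Rightarrow> 'a) \<Rightarrow> real"

definition lie_group ::
  "('g::{t2_space, second_countable_topology}, 'a::euclidean_space) stratified \<Rightarrow> bool" where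
  "lie_group G \<longleftrightarrow>
     group G \<and> carrier G = UNIV \<and> smooth_atlas (atlas G) \<and>
     smooth_map (prod_atlas (atlas G) (atlas G)) (atlas G) (\<lambda>(x, y). x \<otimes>\<^bsub>G\<^esub> y) \<and>
     smooth_map (atlas G) (atlas G) (\<lambda>x. inv\<^bsub>G\<^esub> x)"

definition lie_alg :: "('g, 'a::real_normed_vector) stratified \<Rightarrow> ('g \<Rightarrow> 'a) set" where
  "lie_alg G =
     {X. smooth_field (atlas G) UNIV X \<and>
         (\<forall>g x. tangent_map (atlas G) (\<lambda>y. g \<otimes>\<^bsub>G\<^esub> y) x (X x) = X (g \<otimes>\<^bsub>G\<^esub> x))}"

definition bracket_span ::
  "('g, 'a::real_normed_vector) stratified \<Rightarrow> ('g \<Rightarrow> 'a) set \<Rightarrow> ('g \<Rightarrow> 'a) set \<Rightarrow> ('g \<Rightarrow> 'a) set" where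
  "bracket_span G V W = field_space.span {lie_bracket (atlas G) X Y | X Y. X \<in> V \<and> Y \<in> W}"

fun lower_central :: "('g, 'a::real_normed_vector) stratified \<Rightarrow> nat \<Rightarrow> ('g \<Rightarrow> 'a) set" where
  "lower_central G 0 = lie_alg G"
| "lower_central G (Suc k) = bracket_span G (lie_alg G) (lower_central G k)"

definition nilpotent :: "('g, 'a::real_normed_vector) stratified \<Rightarrow> bool" where
  "nilpotent G \<longleftrightarrow> (\<exists>k. lower_central G k = {0})"

definition stratification :: "('g, 'a::real_normed_vector) stratified \<Rightarrow> bool" where
  "stratification G \<longleftrightarrow>
     (\<forall>j\<in>{1..step G}. field_space.subspace (layer G j) \<and> layer G j \<subseteq> lie_alg G) \<and>
     field_space.span (\<Union>j\<in>{1..step G}. layer G j) = lie_alg G \<and>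
     (\<forall>X. (\<forall>j\<in>{1..step G}. X j \<in> layer G j) \<and> (\<Sum>j\<in>{1..step G}. X j) = 0 \<longrightarrow>
          (\<forall>j\<in>{1..step G}. X j = 0)) \<and>
     (\<forall>j\<in>{1..<step G}. bracket_span G (layer G 1) (layer G j) = layer G (Suc j)) \<and>
     (\<forall>j\<in>{1..step G}. bracket_span G (layer G j) (layer G (step G)) = {0})"

text \<open>
  An element of \<open>V \<otimes> W\<close> is represented by a list of pairs in \<open>V \<times> W\<close>,
  standing for the sum of the corresponding pure tensors. Different lists may represent the same
  tensor, but the scalar product and the bracket map below depend on the tensor only.
\<close>

definition tensor_sprod ::
  "('g, 'a::real_normed_vector) stratified \<Rightarrow>
   (('g \<Rightarrow> 'a) \<times> ('g \<Rightarrow> 'a)) list \<Rightarrow> (('g \<Rightarrow> 'a) \<times> ('g \<Rightarrow> 'a)) list \<Rightarrow> real" where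
  "tensor_sprod G s t =
     (\<Sum>(X, Y)\<leftarrow>s. \<Sum>(X', Y')\<leftarrow>t. sprod G X X' * sprod G Y Y')"

definition bracket_tensor ::
  "('g, 'a::real_normed_vector) stratified \<Rightarrow> (('g \<Rightarrow> 'a) \<times> ('g \<Rightarrow> 'a)) list \<Rightarrow> 'g \<Rightarrow> 'a" where
  "bracket_tensor G s = (\<Sum>(X, Y)\<leftarrow>s. lie_bracket (atlas G) X Y)"

definition bracket_ker_perp ::
  "('g, 'a::real_normed_vector) stratified \<Rightarrow> nat \<Rightarrow> (('g \<Rightarrow> 'a) \<times> ('g \<Rightarrow> 'a)) list set" where
  "bracket_ker_perp G k =
     {s \<in> lists (layer G 1 \<times> layer G k).
        \<forall>t \<in> lists (layer G 1 \<times> layer G k). bracket_tensor G t = 0 \<longrightarrow> tensor_sprod G s t = 0}"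

text \<open>
  Surjectivity of the bracket map onto the next layer is part of \<open>stratification\<close>.
\<close>

definition stratified_sprod :: "('g, 'a::real_normed_vector) stratified \<Rightarrow> bool" where
  "stratified_sprod G \<longleftrightarrow>
     (\<forall>X\<in>lie_alg G. \<forall>Y\<in>lie_alg G. \<forall>Z\<in>lie_alg G. \<forall>a b.
        sprod G (field_scale a X + field_scale b Y) Z = a * sprod G X Z + b * sprod G Y Z) \<and>
     (\<forall>X\<in>lie_alg G. \<forall>Y\<in>lie_alg G. sprod G X Y = sprod G Y X) \<and>
     (\<forall>X\<in>lie_alg G. X \<noteq> 0 \<longrightarrow> sprod G X X > 0) \<and>
     (\<forall>i\<in>{1..step G}. \<forall>j\<in>{1..step G}. i \<noteq> j \<longrightarrow>
        (\<forall>X\<in>layer G i. \<forall>Y\<in>layer G j. sprod G X Y = 0)) \<and>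
     (\<forall>k\<in>{1..<step G}. \<forall>s\<in>bracket_ker_perp G k. \<forall>t\<in>bracket_ker_perp G k.
        sprod G (bracket_tensor G s) (bracket_tensor G t) = tensor_sprod G s t)"

definition stratified_group ::
  "('g::{t2_space, second_countable_topology}, 'a::euclidean_space) stratified \<Rightarrow> bool" where
  "stratified_group G \<longleftrightarrow>
     lie_group G \<and> connected (UNIV :: 'g set) \<and> simply_connected (UNIV :: 'g set) \<and>
     nilpotent G \<and> stratification G \<and> stratified_sprod G"

definition layer_dim :: "('g, 'a::real_normed_vector) stratified \<Rightarrow> nat \<Rightarrow> nat" where
  "layer_dim G j = field_space.dim (layer G j)"

definition hausdorff_dim :: "('g, 'a::real_normed_vector) stratified \<Rightarrow> nat" where
  "hausdorff_dim G = (\<Sum>j\<in>{1..step G}. j * layer_dim G j)"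

definition horizontal :: "('g, 'a::real_normed_vector) stratified \<Rightarrow> 'g \<Rightarrow> 'a set" where
  "horizontal G x = (\<lambda>X. X x) ` layer G 1"

definition left_inv_ext :: "('g, 'a::real_normed_vector) stratified \<Rightarrow> 'g \<Rightarrow> 'a \<Rightarrow> 'g \<Rightarrow> 'a" where
  "left_inv_ext G x \<xi> = (THE X. X \<in> lie_alg G \<and> X x = \<xi>)"

definition riem :: "('g, 'a::real_normed_vector) stratified \<Rightarrow> 'g \<Rightarrow> 'a \<Rightarrow> 'a \<Rightarrow> real" where
  "riem G x \<xi> \<eta> = sprod G (left_inv_ext G x \<xi>) (left_inv_ext G x \<eta>)"

text \<open>All frames are indexed from \<open>0\<close>: the frame elements are \<open>e 0, \<dots>, e (n - 1)\<close>.\<close>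

definition adapted_basis ::
  "('g, 'a::euclidean_space) stratified \<Rightarrow> (nat \<Rightarrow> 'g \<Rightarrow> 'a) \<Rightarrow> bool" where
  "adapted_basis G e \<longleftrightarrow>
     field_space.span (e ` {..<DIM('a)}) = lie_alg G \<and>
     (\<forall>i<DIM('a). \<forall>j<DIM('a). sprod G (e i) (e j) = (if i = j then 1 else 0)) \<and>
     (\<forall>j\<in>{1..step G}.
        field_space.span (e ` {\<Sum>k\<in>{1..<j}. layer_dim G k ..< \<Sum>k\<in>{1..j}. layer_dim G k})
          = layer G j)"

definition field_degree :: "('g, 'a::real_normed_vector) stratified \<Rightarrow> ('g \<Rightarrow> 'a) \<Rightarrow> nat" where
  "field_degree G X = (THE j. j \<in> {1..step G} \<and> X \<in> layer G j)"


section \<open>Covectors and multivectors\<close>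

definition dual_basis :: "(nat \<Rightarrow> 'a::euclidean_space) \<Rightarrow> nat \<Rightarrow> 'a \<Rightarrow> real" where
  "dual_basis b i \<xi> = representation (b ` {..<DIM('a)}) \<xi> (b i)"

text \<open>The wedge product of the covectors \<open>\<phi> 0, \<dots>, \<phi> (k - 1)\<close>, evaluated at
  \<open>w 0, \<dots>, w (k - 1)\<close>.\<close>

definition wedge_form :: "nat \<Rightarrow> (nat \<Rightarrow> 'a \<Rightarrow> real) \<Rightarrow> (nat \<Rightarrow> 'a) \<Rightarrow> real" where
  "wedge_form k \<phi> w = Determinant.det (Matrix.mat k k (\<lambda>(i, j). \<phi> i (w j)))"

text \<open>
  A \<open>k\<close>-vector is represented by its components with respect to the basis of \<open>k\<close>-vectors
  induced by a basis \<open>b\<close>; the component at \<open>b (i\<^sub>1) \<and> \<dots> \<and> b (i\<^sub>k)\<close>, \<open>i\<^sub>1 < \<dots> < i\<^sub>k\<close>, is the value at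
  the index set \<open>{i\<^sub>1, \<dots>, i\<^sub>k}\<close>. If \<open>b\<close> is orthonormal, so is the induced basis.
\<close>

definition wedge_vec ::
  "nat \<Rightarrow> (nat \<Rightarrow> 'a::euclidean_space) \<Rightarrow> (nat \<Rightarrow> 'a) \<Rightarrow> nat set \<Rightarrow> real" where
  "wedge_vec k b w K =
     (if K \<subseteq> {..<DIM('a)} \<and> card K = k
      then wedge_form k (\<lambda>i. dual_basis b (sorted_list_of_set K ! i)) w else 0)"

definition mv_norm :: "nat \<Rightarrow> (nat set \<Rightarrow> real) \<Rightarrow> real" where
  "mv_norm n t = sqrt (\<Sum>K\<in>Pow {..<n}. (t K)\<^sup>2)"

definition degree_part ::
  "('g, 'a::real_normed_vector) stratified \<Rightarrow> (nat \<Rightarrow> 'g \<Rightarrow> 'a) \<Rightarrow> nat \<Rightarrow>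
   (nat set \<Rightarrow> real) \<Rightarrow> nat set \<Rightarrow> real" where
  "degree_part G e d t K = (if (\<Sum>i\<in>K. field_degree G (e i)) = d then t K else 0)"


section \<open>Submanifolds\<close>

text \<open>The compatibility of the chart \<open>c\<close> with the atlas \<open>A\<close> is expressed by
  \<open>smooth_atlas (insert c A)\<close>.\<close>

definition slice_chart ::
  "('g::topological_space, 'a::euclidean_space) chart set \<Rightarrow> nat \<Rightarrow> 'g set \<Rightarrow>
   ('g, 'a) chart \<Rightarrow> 'a list \<Rightarrow> bool" where
  "slice_chart A p M c bs \<longleftrightarrow>
     smooth_atlas (insert c A) \<and>
     distinct bs \<and> set bs \<subseteq> Basis \<and> p + length bs = DIM('a) \<and>
     snd c ` (M \<inter> fst c) = snd c ` fst c \<inter> span (set bs)"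

definition submanifold ::
  "('g::topological_space, 'a::euclidean_space) chart set \<Rightarrow> nat \<Rightarrow> 'g set \<Rightarrow> bool" where
  "submanifold A p M \<longleftrightarrow> (\<forall>x\<in>M. \<exists>c bs. slice_chart A p M c bs \<and> x \<in> fst c)"

text \<open>The tangent space consists of the velocities of curves in \<open>M\<close>.\<close>

definition tangent_space ::
  "('g, 'a::real_normed_vector) chart set \<Rightarrow> 'g set \<Rightarrow> 'g \<Rightarrow> 'a set" where
  "tangent_space A M x =
     {\<xi>. \<exists>\<gamma>::real \<Rightarrow> 'g. \<exists>\<epsilon>>0. \<gamma> 0 = x \<and> (\<forall>t. \<bar>t\<bar> < \<epsilon> \<longrightarrow> \<gamma> t \<in> M \<inter> fst (base_chart A x)) \<and>
          ((snd (base_chart A x) \<circ> \<gamma>) has_vector_derivative \<xi>) (at 0)}"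

definition non_horizontal ::
  "('g, 'a::real_normed_vector) stratified \<Rightarrow> 'g set \<Rightarrow> bool" where
  "non_horizontal G M \<longleftrightarrow>
     (\<forall>x\<in>M. {\<xi> + \<eta> | \<xi> \<eta>. \<xi> \<in> tangent_space (atlas G) M x \<and> \<eta> \<in> horizontal G x} = UNIV)"

definition horizontal_normal ::
  "('g, 'a::real_normed_vector) stratified \<Rightarrow> 'g set \<Rightarrow> 'g \<Rightarrow> 'a set" where
  "horizontal_normal G M x =
     {\<xi> \<in> horizontal G x. \<forall>\<eta> \<in> tangent_space (atlas G) M x \<inter> horizontal G x. riem G x \<xi> \<eta> = 0}"

definition riem_normal ::
  "('g, 'a::real_normed_vector) stratified \<Rightarrow> 'g set \<Rightarrow> 'g \<Rightarrow> 'a set" where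
  "riem_normal G M x = {\<xi>. \<forall>\<eta> \<in> tangent_space (atlas G) M x. riem G x \<xi> \<eta> = 0}"

definition normal_frame_at ::
  "('g, 'a::real_normed_vector) stratified \<Rightarrow> nat \<Rightarrow> 'g set \<Rightarrow> (nat \<Rightarrow> 'g \<Rightarrow> 'a) \<Rightarrow> 'g \<Rightarrow> bool" where
  "normal_frame_at G p M v x \<longleftrightarrow>
     span ((\<lambda>i. v i x) ` {..<p}) = riem_normal G M x \<and>
     (\<forall>i<p. \<forall>j<p. riem G x (v i x) (v j x) = (if i = j then 1 else 0))"

text \<open>The contraction of \<open>v\<^sub>1 \<and> \<dots> \<and> v\<^sub>p\<close> with the volume form, evaluated at vectors \<open>w\<close>
  tangent to \<open>M\<close>.\<close>

definition induced_volume ::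
  "(nat \<Rightarrow> 'g \<Rightarrow> 'a::euclidean_space) \<Rightarrow> nat \<Rightarrow> (nat \<Rightarrow> 'g \<Rightarrow> 'a) \<Rightarrow> 'g \<Rightarrow> (nat \<Rightarrow> 'a) \<Rightarrow> real" where
  "induced_volume e p v x w =
     wedge_form DIM('a) (dual_basis (\<lambda>i. e i x)) (\<lambda>i. if i < p then v i x else w (i - p))"

definition unit_tangent_mv ::
  "('g, 'a::euclidean_space) stratified \<Rightarrow> (nat \<Rightarrow> 'g \<Rightarrow> 'a) \<Rightarrow> nat \<Rightarrow> 'g set \<Rightarrow> 'g \<Rightarrow>
   (nat set \<Rightarrow> real) \<Rightarrow> bool" where
  "unit_tangent_mv G e k M x t \<longleftrightarrow>
     (\<exists>w. (\<forall>i<k. w i \<in> tangent_space (atlas G) M x) \<and> t = wedge_vec k (\<lambda>i. e i x) w) \<and>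
     mv_norm DIM('a) t = 1"

definition adapted_frame ::
  "('g::topological_space, 'a::euclidean_space) stratified \<Rightarrow> (nat \<Rightarrow> 'g \<Rightarrow> 'a) \<Rightarrow> nat \<Rightarrow>
   'g set \<Rightarrow> 'g set \<Rightarrow> (nat \<Rightarrow> 'g \<Rightarrow> 'a) \<Rightarrow> bool" where
  "adapted_frame G e p M U f \<longleftrightarrow>
     open U \<and> M \<inter> U \<noteq> {} \<and>
     (\<forall>i<DIM('a). smooth_field (atlas G) U (f i)) \<and>
     (\<forall>x\<in>U.
        inj_on (\<lambda>i. f i x) {..<DIM('a)} \<and> independent ((\<lambda>i. f i x) ` {..<DIM('a)}) \<and>
        span ((\<lambda>i. f i x) ` {..<layer_dim G 1}) = horizontal G x \<and>
        (\<forall>i<layer_dim G 1. \<forall>j<layer_dim G 1.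
           riem G x (f i x) (f j x) = (if i = j then 1 else 0))) \<and>
     (\<forall>x\<in>M \<inter> U.
        span ((\<lambda>i. f i x) ` {..<p}) = horizontal_normal G M x \<and>
        span ((\<lambda>i. f i x) ` {p..<layer_dim G 1}) =
          tangent_space (atlas G) M x \<inter> horizontal G x) \<and>
     (\<exists>a :: nat \<Rightarrow> nat \<Rightarrow> 'g \<Rightarrow> real. \<forall>x\<in>M \<inter> U. \<forall>j\<in>{layer_dim G 1..<DIM('a)}.
        f j x = e j x - (\<Sum>\<alpha><p. a j \<alpha> x *\<^sub>R f \<alpha> x) \<and> f j x \<in> tangent_space (atlas G) M x)"


section \<open>Measures with a given density\<close>

text \<open>Lebesgue measure on the span of a set of coordinate vectors (cf. the definition of
  \<open>lborel\<close>, which is the case \<open>B = Basis\<close>).\<close>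

definition lborel_on :: "'a::euclidean_space set \<Rightarrow> 'a measure" where
  "lborel_on B = distr (\<Pi>\<^sub>M b\<in>B. lborel) borel (\<lambda>u. \<Sum>b\<in>B. u b *\<^sub>R b)"

text \<open>
  On \<open>M \<inter> U\<close>, the measure \<open>\<mu>\<close> on \<open>M\<close> has the density given by the absolute value of the
  form \<open>\<omega>\<close> of degree \<open>dim M\<close>: in every slice chart inside \<open>U\<close> it is computed by integrating
  the absolute value of the coordinate expression of \<open>\<omega>\<close>.
\<close>

definition has_form_density ::
  "('g::topological_space, 'a::euclidean_space) chart set \<Rightarrow> nat \<Rightarrow> 'g set \<Rightarrow> 'g set \<Rightarrow>
   'g measure \<Rightarrow> ('g \<Rightarrow> (nat \<Rightarrow> 'a) \<Rightarrow> real) \<Rightarrow> bool" where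
  "has_form_density A p M U \<mu> \<omega> \<longleftrightarrow>
     (\<forall>c bs. slice_chart A p M c bs \<and> fst c \<subseteq> U \<longrightarrow>
        (\<forall>E\<in>sets \<mu>. E \<subseteq> fst c \<longrightarrow>
           emeasure \<mu> E =
             (\<integral>\<^sup>+u. ennreal \<bar>\<omega> (chart_inv c u) (\<lambda>i. from_chart A c (chart_inv c u) (bs ! i))\<bar>
                  * indicator (snd c ` E) u \<partial>lborel_on (set bs))))"

end

theory Submission
  imports Defs
begin

text \<open>
  Everything happens at a single point. Let \<open>F\<close> denote the fields \<open>f\<^sub>p\<^sub>+\<^sub>1, \<dots>, f\<^sub>n\<close>, a basis of the
  tangent space, let \<open>v\<close> be the orthonormal normal frame, and let \<open>\<tau> = c \<cdot> \<And>F\<close>, so that \<open>1 = \<bar>c\<bar> \<bar>\<And>F\<bar>\<close>.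
  By the Cauchy--Binet formula, \<open>\<bar>\<And>F\<bar>\<close> is the square root of the Gram determinant of \<open>F\<close>, and this is
  also the absolute value of the induced volume form on \<open>F\<close>, since \<open>v\<close> is orthonormal and orthogonal
  to \<open>F\<close>. A wedge product of basis vectors has maximal degree iff only horizontal factors are omitted;
  as \<open>f\<^sub>j - e\<^sub>j\<close> is horizontal for the nonhorizontal indices \<open>j\<close>, the components of \<open>\<And>F\<close> of maximal degree
  are the components of the wedge product of the orthonormal horizontal vectors among the \<open>F\<close>, so
  that \<open>\<bar>\<tau>\<^sup>d\<bar> = \<bar>c\<bar>\<close>. Hence \<open>\<bar>\<tau>\<^sup>d\<bar>\<close> times the volume form equals \<open>1\<close> on \<open>F\<close>, up to sign, just
  as the wedge product of the dual coframe. The sign is that of a determinant which depends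
  continuously on the point.
\<close>

section \<open>The Cauchy--Binet formula\<close>

lemma bij_betw_nth_sorted_list:
  assumes "finite K" "card K = m"
  shows "bij_betw (\<lambda>i. sorted_list_of_set K ! i) {0..<m} K"
  using bij_betw_nth[of "sorted_list_of_set K" "{0..<m}" K] assms
  by (simp add: lessThan_atLeast0)

text \<open>The map sending \<open>f\<close> to \<open>s\<close>-inverse after \<open>f\<close>
  identifies the injections with image \<open>K\<close> with the permutations of the index set. Both
  kinds of function are the identity outside \<open>{0..<m}\<close>, so each is determined by its
  restriction.\<close>

lemma sum_injections_onto:
  fixes h :: "(nat \<Rightarrow> nat) \<Rightarrow> 'a::comm_monoid_add"
  assumes s: "bij_betw s {0..<m} K"
  shows "sum h {f. f ` {0..<m} = K \<and> inj_on f {0..<m} \<and> (\<forall>i. i \<notin> {0..<m} \<longrightarrow> f i = i)} =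
    (\<Sum>p | p permutes {0..<m}. h (\<lambda>i. if i < m then s (p i) else i))"
proof (rule sum.reindex_bij_witness[where
      i = "\<lambda>p i. if i < m then s (p i) else i" and
      j = "\<lambda>f i. if i < m then inv_into {0..<m} s (f i) else i"])
  let ?r = "inv_into {0..<m} s"
  have r: "bij_betw ?r K {0..<m}" by (rule bij_betw_inv_into[OF s])
  have sr: "s (?r k) = k" if "k \<in> K" for k using s that by (simp add: bij_betw_inv_into_right)
  fix f assume f: "f \<in> {f. f ` {0..<m} = K \<and> inj_on f {0..<m} \<and> (\<forall>i. i \<notin> {0..<m} \<longrightarrow> f i = i)}"
  then have fK: "f i \<in> K" if "i < m" for i using that by auto
  show eq: "(\<lambda>i. if i < m then s (if i < m then ?r (f i) else i) else i) = f"
    using f sr fK by (auto simp: fun_eq_iff)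
  show "h (\<lambda>i. if i < m then s (if i < m then ?r (f i) else i) else i) = h f"
    by (simp only: eq)
  have "bij_betw (?r \<circ> f) {0..<m} {0..<m}"
    by (rule bij_betw_trans[OF _ r]) (use f in \<open>auto simp: bij_betw_def\<close>)
  then have "bij_betw (\<lambda>i. if i < m then ?r (f i) else i) {0..<m} {0..<m}"
    by (rule bij_betw_cong[THEN iffD1, rotated]) auto
  then show "(\<lambda>i. if i < m then ?r (f i) else i) \<in> {p. p permutes {0..<m}}"
    by (auto intro: bij_imp_permutes)
next
  let ?r = "inv_into {0..<m} s"
  have rs: "?r (s i) = i" if "i < m" for i using s that by (simp add: bij_betw_inv_into_left)
  fix p assume p: "p \<in> {p. p permutes {0..<m}}"
  then have pm: "p i < m" if "i < m" for i using that permutes_in_image[of p "{0..<m}" i] by auto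
  have out: "p i = i" if "\<not> i < m" for i using p that by (auto simp: permutes_def)
  show "(\<lambda>i. if i < m then ?r (if i < m then s (p i) else i) else i) = p"
    using rs pm out by (auto simp: fun_eq_iff)
  have "bij_betw (s \<circ> p) {0..<m} K"
    using p s by (intro bij_betw_trans[OF permutes_imp_bij]) auto
  then have "bij_betw (\<lambda>i. if i < m then s (p i) else i) {0..<m} K"
    by (rule bij_betw_cong[THEN iffD1, rotated]) auto
  then show "(\<lambda>i. if i < m then s (p i) else i) \<in>
      {f. f ` {0..<m} = K \<and> inj_on f {0..<m} \<and> (\<forall>i. i \<notin> {0..<m} \<longrightarrow> f i = i)}"
    by (auto simp: bij_betw_def)
qed

lemma det_permute_row_family:
  fixes B :: "nat \<Rightarrow> nat \<Rightarrow> 'a::comm_ring_1"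
  assumes "p permutes {0..<m}"
  shows "det (mat m m (\<lambda>(i, j). B (s (p i)) j)) = signof p * det (mat m m (\<lambda>(i, j). B (s i) j))"
proof -
  have pm: "p i < m" if "i < m" for i using assms that permutes_in_image[of p "{0..<m}" i] by auto
  have "mat m m (\<lambda>(i, j). B (s (p i)) j) = mat m m (\<lambda>(i, j). mat m m (\<lambda>(i, j). B (s i) j) $$ (p i, j))"
    by (rule eq_matI) (auto simp: pm)
  then show ?thesis
    by (simp add: det_permute_rows[OF mat_carrier assms])
qed

text \<open>Multilinearity in the rows gives a sum over all maps \<open>f\<close> selecting a row of
  \<open>B\<close> for each row index. Maps that repeat a row contribute zero; the injective ones
  are grouped by their image \<open>K\<close>, and each group is the Leibniz expansion of the minor
  of \<open>A\<close> at \<open>K\<close>, times the minor of \<open>B\<close>.\<close>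

lemma cauchy_binet:
  fixes A B :: "nat \<Rightarrow> nat \<Rightarrow> 'a::comm_ring_1"
  shows "det (mat m m (\<lambda>(i, j). \<Sum>k<n. A k i * B k j)) =
    (\<Sum>K | K \<subseteq> {..<n} \<and> card K = m.
       det (mat m m (\<lambda>(i, j). A (sorted_list_of_set K ! i) j)) *
       det (mat m m (\<lambda>(i, j). B (sorted_list_of_set K ! i) j)))"
proof -
  define F where "F = {f. (\<forall>i\<in>{0..<m}. f i \<in> {..<n}) \<and> (\<forall>i. i \<notin> {0..<m} \<longrightarrow> f i = i)}"
  define h where "h f = (\<Prod>i\<in>{0..<m}. A (f i) i) * det (mat m m (\<lambda>(i, j). B (f i) j))" for f
  define S where "S = {K. K \<subseteq> {..<n} \<and> card K = m}"
  define In where "In K = {f. f ` {0..<m} = K \<and> inj_on f {0..<m} \<and> (\<forall>i. i \<notin> {0..<m} \<longrightarrow> f i = i)}" for K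
  have finF: "finite F" unfolding F_def by (rule finite_bounded_functions) auto
  have finS: "finite S" unfolding S_def by (rule finite_subset[of _ "Pow {..<n}"]) auto
  \<comment> \<open>Row \<open>i\<close> is the combination of the rows of \<open>B\<close> with
    coefficients \<open>A k i\<close>, the form to which multilinearity of the determinant
    applies.\<close>
  have "mat m m (\<lambda>(i, j). \<Sum>k<n. A k i * B k j) =
    mat\<^sub>r m m (\<lambda>i. finsum_vec TYPE('a) m (\<lambda>k. A k i \<cdot>\<^sub>v vec m (B k)) {..<n})"
    by (rule eq_matI) (auto simp: index_finsum_vec)
  then have "det (mat m m (\<lambda>(i, j). \<Sum>k<n. A k i * B k j)) =
    (\<Sum>f\<in>F. det (mat\<^sub>r m m (\<lambda>i. A (f i) i \<cdot>\<^sub>v vec m (B (f i)))))"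
    unfolding F_def by (simp only:) (rule det_linear_rows_sum, auto)
  also have "\<dots> = sum h F"
  proof (rule sum.cong[OF refl])
    fix f
    have "mat\<^sub>r m m (\<lambda>i. vec m (B (f i))) = mat m m (\<lambda>(i, j). B (f i) j)"
      by (rule eq_matI) auto
    then show "det (mat\<^sub>r m m (\<lambda>i. A (f i) i \<cdot>\<^sub>v vec m (B (f i)))) = h f"
      unfolding h_def by (subst det_rows_mul) auto
  qed
  also have "\<dots> = sum h {f \<in> F. inj_on f {0..<m}}"
  proof (rule sum.mono_neutral_right[OF finF], blast, rule ballI)
    fix f assume "f \<in> F - {f \<in> F. inj_on f {0..<m}}"
    then have ninj: "\<not> inj_on f {0..<m}" by blast
    then obtain i j where ij: "i < m" "j < m" "i \<noteq> j" "f i = f j"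
      unfolding inj_on_def by auto
    have "det (mat m m (\<lambda>(i, j). B (f i) j)) = 0"
      by (rule det_identical_rows[OF mat_carrier ij(3,1,2)]) (use ij in auto)
    then show "h f = 0" by (simp add: h_def)
  qed
  also have "{f \<in> F. inj_on f {0..<m}} = (\<Union>K\<in>S. In K)"
  proof (intro equalityI subsetI)
    fix f assume "f \<in> {f \<in> F. inj_on f {0..<m}}"
    then have "f ` {0..<m} \<in> S" "f \<in> In (f ` {0..<m})"
      by (auto simp: F_def S_def In_def card_image)
    then show "f \<in> (\<Union>K\<in>S. In K)" by blast
  qed (auto simp: F_def S_def In_def)
  also have "sum h (\<Union>K\<in>S. In K) = (\<Sum>K\<in>S. sum h (In K))"
  proof (rule sum.UNION_disjoint[OF finS])
    show "\<forall>K\<in>S. finite (In K)"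
      by (intro ballI, rule finite_subset[OF _ finF]) (auto simp: F_def S_def In_def)
  qed (auto simp: In_def)
  also have "\<dots> = (\<Sum>K\<in>S. det (mat m m (\<lambda>(i, j). A (sorted_list_of_set K ! i) j)) *
       det (mat m m (\<lambda>(i, j). B (sorted_list_of_set K ! i) j)))"
  proof (rule sum.cong[OF refl])
    fix K assume "K \<in> S"
    then have K: "finite K" "card K = m" by (auto simp: S_def intro: finite_subset)
    let ?s = "\<lambda>i. sorted_list_of_set K ! i"
    have "sum h (In K) = (\<Sum>p | p permutes {0..<m}. h (\<lambda>i. if i < m then ?s (p i) else i))"
      unfolding In_def by (rule sum_injections_onto[OF bij_betw_nth_sorted_list[OF K]])
    also have "\<dots> = (\<Sum>p | p permutes {0..<m}.
        signof p * (\<Prod>i\<in>{0..<m}. A (?s (p i)) i) * det (mat m m (\<lambda>(i, j). B (?s i) j)))"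
    proof (rule sum.cong[OF refl])
      fix p assume "p \<in> {p. p permutes {0..<m}}"
      then have p: "p permutes {0..<m}" by simp
      have "mat m m (\<lambda>(i, j). B (if i < m then ?s (p i) else i) j) = mat m m (\<lambda>(i, j). B (?s (p i)) j)"
        by (rule eq_matI) auto
      then show "h (\<lambda>i. if i < m then ?s (p i) else i) =
        signof p * (\<Prod>i\<in>{0..<m}. A (?s (p i)) i) * det (mat m m (\<lambda>(i, j). B (?s i) j))"
        unfolding h_def using det_permute_row_family[OF p, of B ?s] by (simp add: mult_ac)
    qed
    also have "\<dots> = det (mat m m (\<lambda>(i, j). A (?s i) j)) * det (mat m m (\<lambda>(i, j). B (?s i) j))"
    proof -
      \<comment> \<open>The Leibniz formula is taken with the permutation acting on the row index,
        to match the factors \<open>A (?s (p i)) i\<close> produced by the expansion.\<close>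
      have "det (mat m m (\<lambda>(i, j). A (?s i) j)) =
        (\<Sum>p | p permutes {0..<m}. signof p * (\<Prod>i\<in>{0..<m}. A (?s (p i)) i))"
      proof (subst mat_det_left_def[OF mat_carrier], rule sum.cong)
        fix p assume "p \<in> {p. p permutes {0..<m}}"
        then have "p i < m" if "i < m" for i using that permutes_in_image[of p "{0..<m}" i] by auto
        then have "(\<Prod>i\<in>{0..<m}. mat m m (\<lambda>(i, j). A (?s i) j) $$ (p i, i)) = (\<Prod>i\<in>{0..<m}. A (?s (p i)) i)"
          by (intro prod.cong) auto
        then show "signof p * (\<Prod>i = 0..<dim_row (mat m m (\<lambda>(i, j). A (?s i) j)).
              mat m m (\<lambda>(i, j). A (?s i) j) $$ (p i, i)) = signof p * (\<Prod>i\<in>{0..<m}. A (?s (p i)) i)"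
          by simp
      qed auto
      then show ?thesis by (simp add: sum_distrib_right)
    qed
    finally show "sum h (In K) = det (mat m m (\<lambda>(i, j). A (?s i) j)) * det (mat m m (\<lambda>(i, j). B (?s i) j))" .
  qed
  finally show ?thesis by (simp add: S_def)
qed

section \<open>Families and frames\<close>

lemma det_block_upper_triangular:
  fixes M :: "nat \<Rightarrow> nat \<Rightarrow> 'a::idom"
  assumes "\<And>i j. a \<le> i \<Longrightarrow> i < a + b \<Longrightarrow> j < a \<Longrightarrow> M i j = 0"
  shows "det (mat (a + b) (a + b) (\<lambda>(i, j). M i j)) =
    det (mat a a (\<lambda>(i, j). M i j)) * det (mat b b (\<lambda>(i, j). M (a + i) (a + j)))"
proof -
  have "mat (a + b) (a + b) (\<lambda>(i, j). M i j) =
    four_block_mat (mat a a (\<lambda>(i, j). M i j)) (mat a b (\<lambda>(i, j). M i (a + j)))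
      (0\<^sub>m b a) (mat b b (\<lambda>(i, j). M (a + i) (a + j)))"
    by (rule eq_matI) (auto simp: assms)
  also have "det \<dots> = det (mat a a (\<lambda>(i, j). M i j)) * det (mat b b (\<lambda>(i, j). M (a + i) (a + j)))"
    by (rule det_four_block_mat_lower_left_zero) auto
  finally show ?thesis .
qed

text \<open>Translates independence of a set into vanishing of coefficients of an indexed family. It
  is proved for an arbitrary vector space because both the model space and the space of vector
  fields use it.\<close>

lemma (in vector_space) independent_family_iff:
  assumes "finite I"
  shows "inj_on b I \<and> independent (b ` I) \<longleftrightarrow>
    (\<forall>c. (\<Sum>i\<in>I. c i *s b i) = 0 \<longrightarrow> (\<forall>i\<in>I. c i = 0))"
proof (intro iffI conjI allI impI ballI)
  fix c i
  assume b: "inj_on b I \<and> independent (b ` I)" and c: "(\<Sum>i\<in>I. c i *s b i) = 0" and i: "i \<in> I"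
  have "(\<Sum>v\<in>b ` I. c (inv_into I b v) *s v) = 0"
    using b c by (subst sum.reindex) auto
  then have "c (inv_into I b (b i)) = 0"
    using b i assms by (intro independentD[of "b ` I" "b ` I" "\<lambda>v. c (inv_into I b v)"]) auto
  then show "c i = 0" using b i by simp
next
  assume *: "\<forall>c. (\<Sum>i\<in>I. c i *s b i) = 0 \<longrightarrow> (\<forall>i\<in>I. c i = 0)"
  show inj: "inj_on b I"
  proof (rule inj_onI, rule ccontr)
    fix i j assume ij: "i \<in> I" "j \<in> I" "b i = b j" "i \<noteq> j"
    \<comment> \<open>A repeated vector would give the nontrivial relation
      \<open>b i - b j = 0\<close>.\<close>
    let ?c = "\<lambda>k. if k = i then 1 else if k = j then - 1 else 0 :: 'a"
    have "(\<Sum>k\<in>I. ?c k *s b k) = (\<Sum>k\<in>I. (if k = i then b i else 0) + (if k = j then - b j else 0))"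
      using ij by (intro sum.cong) auto
    also have "\<dots> = 0"
      using ij assms by (simp add: sum.distrib)
    finally have "\<forall>k\<in>I. ?c k = 0" using spec[OF *, of ?c] by (rule rev_mp)
    from bspec[OF this ij(1)] show False by simp
  qed
  show "independent (b ` I)"
  proof
    assume "dependent (b ` I)"
    then obtain u v where u: "v \<in> b ` I" "u v \<noteq> 0" "(\<Sum>v\<in>b ` I. u v *s v) = 0"
      using assms by (auto simp: dependent_finite)
    then have "(\<Sum>i\<in>I. u (b i) *s b i) = 0"
      using inj by (simp add: sum.reindex)
    then have "\<forall>i\<in>I. u (b i) = 0" using spec[OF *, of "\<lambda>i. u (b i)"] by (rule rev_mp)
    then show False using u by blast
  qed
qed

lemma (in vector_space) span_family:
  assumes "finite I"
  shows "x \<in> span (b ` I) \<longleftrightarrow> (\<exists>c. x = (\<Sum>i\<in>I. c i *s b i))"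
proof
  show "\<exists>c. x = (\<Sum>i\<in>I. c i *s b i)" if "x \<in> span (b ` I)"
    using assms that
  proof (induction I arbitrary: x)
    case (insert i I)
    then obtain k where "x - k *s b i \<in> span (b ` I)"
      by (auto simp: span_insert)
    then obtain c where "x - k *s b i = (\<Sum>i\<in>I. c i *s b i)"
      using insert.IH by blast
    then have "x = k *s b i + (\<Sum>i\<in>I. c i *s b i)" by (simp add: algebra_simps)
    \<comment> \<open>The coefficient at the new index is overwritten, so the value that the
      induction hypothesis assigns to \<open>c i\<close> does not matter.\<close>
    also have "\<dots> = (\<Sum>j\<in>insert i I. (c(i := k)) j *s b j)"
      using insert.hyps by (auto intro!: sum.cong)
    finally show ?case by blast
  qed simp
  show "x \<in> span (b ` I)" if "\<exists>c. x = (\<Sum>i\<in>I. c i *s b i)"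
    using that by (elim exE) (simp only:, intro span_sum span_scale span_base imageI)
qed


section \<open>Frames of the model space and their dual coframes\<close>

text \<open>The ordering is kept because determinants depend on it. Injectivity turns independence
  of the image set into independence of the family, which is then a basis by counting.\<close>

definition frame :: "(nat \<Rightarrow> 'a::euclidean_space) \<Rightarrow> bool" where
  "frame b \<longleftrightarrow> inj_on b {..<DIM('a)} \<and> independent (b ` {..<DIM('a)})"

lemma frameI:
  fixes b :: "nat \<Rightarrow> 'a::euclidean_space"
  assumes "\<And>c i. (\<Sum>i<DIM('a). c i *\<^sub>R b i) = 0 \<Longrightarrow> i < DIM('a) \<Longrightarrow> c i = 0"
  shows "frame b"
  using real_vector.independent_family_iff[of "{..<DIM('a)}" b] assms
  by (auto simp: frame_def)

context
  fixes b :: "nat \<Rightarrow> 'a::euclidean_space"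
  assumes b: "frame b"
begin

lemma frame_span: "span (b ` {..<DIM('a)}) = UNIV"
  using card_ge_dim_independent[of "b ` {..<DIM('a)}" UNIV] b
  by (auto simp: frame_def card_image)

lemma dual_basis_linear: "linear (dual_basis b i)"
  unfolding dual_basis_def using b frame_span
  by (intro linearI) (auto simp: representation_add representation_scale frame_def)

lemma dual_basis_basis:
  "i < DIM('a) \<Longrightarrow> j < DIM('a) \<Longrightarrow> dual_basis b i (b j) = (if i = j then 1 else 0)"
  unfolding dual_basis_def using b
  by (subst representation_basis) (auto simp: frame_def inj_on_eq_iff)

lemma frame_expansion: "\<xi> = (\<Sum>i<DIM('a). dual_basis b i \<xi> *\<^sub>R b i)"
proof -
  have "(\<Sum>v\<in>b ` {..<DIM('a)}. representation (b ` {..<DIM('a)}) \<xi> v *\<^sub>R v) = \<xi>"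
    using b frame_span by (intro sum_representation_eq) (auto simp: frame_def)
  then show ?thesis
    using b by (subst (asm) sum.reindex) (auto simp: frame_def dual_basis_def)
qed

lemma dual_basis_sum:
  assumes "k < DIM('a)"
  shows "dual_basis b k (\<Sum>i<DIM('a). c i *\<^sub>R b i) = c k"
  using assms
  by (simp add: linear_sum[OF dual_basis_linear] linear_scale[OF dual_basis_linear] dual_basis_basis
      if_distrib[of "(*) _"] cong: if_cong)

end

section \<open>Wedge products of covectors\<close>

lemma wedge_form_cong:
  "(\<And>i j. i < k \<Longrightarrow> j < k \<Longrightarrow> \<phi> i (w j) = \<psi> i (w' j)) \<Longrightarrow> wedge_form k \<phi> w = wedge_form k \<psi> w'"
  unfolding wedge_form_def by (intro arg_cong[where f = det] eq_matI) auto

text \<open>The matrix of values is a product of the values on \<open>w\<close> with the coefficient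
  matrix, and determinants are multiplicative.\<close>

lemma wedge_form_linear_comb:
  assumes "\<And>i. i < k \<Longrightarrow> linear (\<phi> i)"
  shows "wedge_form k \<phi> (\<lambda>j. \<Sum>l<k. C l j *\<^sub>R w l) =
    wedge_form k \<phi> w * det (mat k k (\<lambda>(l, j). C l j))"
proof -
  have "mat k k (\<lambda>(i, j). \<phi> i (\<Sum>l<k. C l j *\<^sub>R w l)) =
    mat k k (\<lambda>(i, j). \<phi> i (w j)) * mat k k (\<lambda>(l, j). C l j)"
    by (rule eq_matI)
      (auto simp: scalar_prod_def linear_sum[OF assms] linear_scale[OF assms] mult.commute
        lessThan_atLeast0 intro!: sum.cong)
  then show ?thesis
    unfolding wedge_form_def by (simp add: det_mult[of _ k])
qed

section \<open>An adapted frame at a point\<close>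

text \<open>
  The situation at one point of \<open>M\<close>: \<open>ip\<close> is the Riemannian scalar product, \<open>E\<close> the left-invariant
  orthonormal basis, \<open>F\<close> the adapted frame, \<open>q\<close> the dimension of the horizontal layer, \<open>V\<close> the
  orthonormal normal frame and \<open>T\<close> the tangent space of \<open>M\<close>. That \<open>T\<close> is a subspace is not assumed;
  its span is that of \<open>F p, F (p + 1), \<dots>\<close> because \<open>V\<close> has \<open>p\<close> elements.
\<close>

locale adapted_data =
  fixes E F V :: "nat \<Rightarrow> 'a::euclidean_space" and p q :: nat and T :: "'a set"
    and ip :: "'a \<Rightarrow> 'a \<Rightarrow> real"
  assumes E: "frame E" and F: "frame F" and pq: "p \<le> q" "q \<le> DIM('a)"
    and ip: "\<And>\<xi> \<eta>. ip \<xi> \<eta> = (\<Sum>k<DIM('a). dual_basis E k \<xi> * dual_basis E k \<eta>)"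
    and F_hor: "\<And>j k. j < q \<Longrightarrow> q \<le> k \<Longrightarrow> k < DIM('a) \<Longrightarrow> dual_basis E k (F j) = 0"
    and F_orth: "\<And>i j. i < q \<Longrightarrow> j < q \<Longrightarrow> ip (F i) (F j) = (if i = j then 1 else 0)"
    and F_ver: "\<And>j k. q \<le> j \<Longrightarrow> j < DIM('a) \<Longrightarrow> q \<le> k \<Longrightarrow> k < DIM('a) \<Longrightarrow>
      dual_basis E k (F j) = (if k = j then 1 else 0)"
    and F_tan: "\<And>j. p \<le> j \<Longrightarrow> j < DIM('a) \<Longrightarrow> F j \<in> T"
    and V_orth: "\<And>i j. i < p \<Longrightarrow> j < p \<Longrightarrow> ip (V i) (V j) = (if i = j then 1 else 0)"
    and V_perp: "\<And>i w. i < p \<Longrightarrow> w \<in> T \<Longrightarrow> ip (V i) w = 0"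
begin

text \<open>The mixed frame, normal vectors first and tangent vectors after them, through which the
  induced volume form is evaluated.\<close>

definition P :: "nat \<Rightarrow> 'a" where "P i = (if i < p then V i else F i)"

text \<open>The squared volume spanned by the tangent part of the frame. Both the squared norm of
  its wedge product and the square of the induced volume form on it will equal this number.\<close>

definition gram :: real where
  "gram = det (mat (DIM('a) - p) (DIM('a) - p) (\<lambda>(i, j). ip (F (p + i)) (F (p + j))))"

text \<open>The value of the wedge product of the last dual covectors; on tangent vectors it is the
  factor between the wedge product of \<open>w\<close> and that of the tangent frame.\<close>

abbreviation tcoef :: "(nat \<Rightarrow> 'a) \<Rightarrow> real" where
  "tcoef \<equiv> wedge_form (DIM('a) - p) (\<lambda>i. dual_basis F (p + i))"

lemma ip_linear: "linear (ip \<xi>)"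
  unfolding ip by (intro linear_compose_sum ballI linear_times[unfolded o_def, THEN linear_compose[rotated, unfolded o_def]] dual_basis_linear E)

lemma ip_commute: "ip \<xi> \<eta> = ip \<eta> \<xi>"
  unfolding ip by (simp add: mult.commute)

text \<open>Pairing a vanishing combination with \<open>V k\<close> isolates the normal coefficient,
  since \<open>V\<close> is orthonormal and perpendicular to the tangent vectors in
  \<open>F\<close>. What remains is a relation within the frame \<open>F\<close>.\<close>

lemma frame_P: "frame P"
proof (rule frameI)
  fix c i assume c: "(\<Sum>i<DIM('a). c i *\<^sub>R P i) = 0" and i: "i < DIM('a)"
  have small: "c k = 0" if "k < p" for k
  proof -
    have "0 = (\<Sum>i<DIM('a). c i * ip (V k) (P i))"
      using arg_cong[OF c, of "ip (V k)"]
      by (simp add: linear_sum[OF ip_linear] linear_scale[OF ip_linear] linear_0[OF ip_linear])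
    also have "\<dots> = (\<Sum>i<DIM('a). if i = k then c k else 0)"
      using that by (intro sum.cong) (auto simp: P_def V_orth V_perp F_tan)
    finally show ?thesis using that pq by simp
  qed
  have "(\<Sum>i<DIM('a). c i *\<^sub>R P i) = (\<Sum>i<DIM('a). c i *\<^sub>R F i)"
    by (intro sum.cong) (auto simp: P_def small)
  then show "c i = 0"
    using dual_basis_sum[OF F i, of c] c linear_0[OF dual_basis_linear[OF F]] by simp
qed

text \<open>In the frame \<open>P\<close> a tangent vector has no normal coefficients, by
  perpendicularity to \<open>V\<close>. The remaining terms use only vectors of \<open>F\<close>, so
  uniqueness of the expansion in \<open>F\<close> identifies the coefficients.\<close>

lemma tangent_expansion:
  assumes "w \<in> T"
  shows "w = (\<Sum>l<DIM('a) - p. dual_basis F (p + l) w *\<^sub>R F (p + l))"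
proof -
  let ?\<beta> = "\<lambda>i. dual_basis P i w"
  have small: "?\<beta> k = 0" if k: "k < p" for k
  proof -
    have "0 = ip (V k) (\<Sum>i<DIM('a). ?\<beta> i *\<^sub>R P i)"
      using frame_expansion[OF frame_P, of w] V_perp[OF k assms] by simp
    also have "\<dots> = (\<Sum>i<DIM('a). ?\<beta> i * ip (V k) (P i))"
      by (simp add: linear_sum[OF ip_linear] linear_scale[OF ip_linear])
    also have "\<dots> = (\<Sum>i<DIM('a). if i = k then ?\<beta> k else 0)"
      using k by (intro sum.cong) (auto simp: P_def V_orth V_perp F_tan)
    finally show ?thesis using k pq by simp
  qed
  have "w = (\<Sum>i<DIM('a). ?\<beta> i *\<^sub>R P i)" by (rule frame_expansion[OF frame_P])
  also have "\<dots> = (\<Sum>i<DIM('a). ?\<beta> i *\<^sub>R F i)"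
    by (intro sum.cong) (auto simp: P_def small)
  finally have w: "w = (\<Sum>i<DIM('a). ?\<beta> i *\<^sub>R F i)" .
  then have eq: "dual_basis F i w = ?\<beta> i" if "i < DIM('a)" for i
    using dual_basis_sum[OF F that, of ?\<beta>] by simp
  have "w = (\<Sum>i\<in>{p..<DIM('a)}. dual_basis F i w *\<^sub>R F i)"
    by (subst w, rule sum.mono_neutral_cong_right) (auto simp: eq small)
  also have "\<dots> = (\<Sum>l<DIM('a) - p. dual_basis F (p + l) w *\<^sub>R F (p + l))"
    by (rule sum.reindex_bij_witness[where i = "\<lambda>l. p + l" and j = "\<lambda>i. i - p"]) auto
  finally show ?thesis .
qed

section \<open>Forms and volume on tangent vectors\<close>

lemma wedge_form_tangent:
  assumes "\<And>i. i < DIM('a) - p \<Longrightarrow> linear (\<phi> i)" and w: "\<And>j. j < DIM('a) - p \<Longrightarrow> w j \<in> T"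
  shows "wedge_form (DIM('a) - p) \<phi> w = wedge_form (DIM('a) - p) \<phi> (\<lambda>l. F (p + l)) * tcoef w"
proof -
  have "wedge_form (DIM('a) - p) \<phi> w =
    wedge_form (DIM('a) - p) \<phi> (\<lambda>j. \<Sum>l<DIM('a) - p. dual_basis F (p + l) (w j) *\<^sub>R F (p + l))"
    using tangent_expansion[OF w] by (intro wedge_form_cong) metis
  then show ?thesis
    by (simp only: wedge_form_linear_comb[OF assms(1)]) (simp add: wedge_form_def)
qed

lemma volume_tangent:
  assumes w: "\<And>j. j < DIM('a) - p \<Longrightarrow> w j \<in> T"
  shows "wedge_form DIM('a) (dual_basis E) (\<lambda>i. if i < p then V i else w (i - p)) =
    wedge_form DIM('a) (dual_basis E) P * tcoef w"
proof -
  \<comment> \<open>The coefficients of the family \<open>V\<close>, \<open>w\<close> in the frame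
    \<open>P\<close>: a block diagonal matrix with an identity block and a block whose determinant
    is \<open>tcoef w\<close>.\<close>
  let ?C = "\<lambda>l j. if l < p then (if l = j then 1 else 0)
    else if j < p then 0 else dual_basis F l (w (j - p))"
  have "(if j < p then V j else w (j - p)) = (\<Sum>l<DIM('a). ?C l j *\<^sub>R P l)" if j: "j < DIM('a)" for j
  proof (cases "j < p")
    case True
    have "(\<Sum>l<DIM('a). ?C l j *\<^sub>R P l) = (\<Sum>l<DIM('a). if l = j then P j else 0)"
      using True by (intro sum.cong) auto
    then show ?thesis using True j by (simp add: P_def)
  next
    case False
    have "w (j - p) = (\<Sum>l<DIM('a) - p. dual_basis F (p + l) (w (j - p)) *\<^sub>R F (p + l))"
      using False j by (intro tangent_expansion w) auto
    also have "\<dots> = (\<Sum>l\<in>{p..<DIM('a)}. dual_basis F l (w (j - p)) *\<^sub>R F l)"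
      by (rule sum.reindex_bij_witness[where j = "\<lambda>l. p + l" and i = "\<lambda>i. i - p"]) auto
    also have "\<dots> = (\<Sum>l<DIM('a). ?C l j *\<^sub>R P l)"
      using False by (intro sum.mono_neutral_cong_left) (auto simp: P_def)
    finally show ?thesis using False by simp
  qed
  then have "wedge_form DIM('a) (dual_basis E) (\<lambda>i. if i < p then V i else w (i - p)) =
    wedge_form DIM('a) (dual_basis E) (\<lambda>j. \<Sum>l<DIM('a). ?C l j *\<^sub>R P l)"
    by (intro wedge_form_cong) simp
  also have "\<dots> = wedge_form DIM('a) (dual_basis E) P * det (mat DIM('a) DIM('a) (\<lambda>(l, j). ?C l j))"
    by (rule wedge_form_linear_comb) (rule dual_basis_linear[OF E])
  also have "det (mat DIM('a) DIM('a) (\<lambda>(l, j). ?C l j)) = tcoef w"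
  proof -
    have "mat p p (\<lambda>(l, j). ?C l j) = 1\<^sub>m p" by (rule eq_matI) auto
    then show ?thesis
      using det_block_upper_triangular[of p "DIM('a) - p" ?C] pq
      by (simp add: wedge_form_def)
  qed
  finally show ?thesis .
qed

text \<open>In the coordinates of the orthonormal \<open>E\<close>, the transposed matrix of
  \<open>P\<close> times the matrix itself is the Gram matrix of \<open>P\<close>. Normal and
  tangent vectors are orthogonal, so it splits into an identity block and the block of
  \<open>gram\<close>.\<close>

lemma volume_square: "(wedge_form DIM('a) (dual_basis E) P)\<^sup>2 = gram"
proof -
  let ?A = "mat DIM('a) DIM('a) (\<lambda>(i, j). dual_basis E i (P j))"
  have "(wedge_form DIM('a) (dual_basis E) P)\<^sup>2 = det (transpose_mat ?A * ?A)"
    by (simp add: det_mult[of _ "DIM('a)"] det_transpose[of _ "DIM('a)"] wedge_form_def power2_eq_square)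
  also have "transpose_mat ?A * ?A = mat DIM('a) DIM('a) (\<lambda>(i, j). ip (P i) (P j))"
    by (rule eq_matI) (auto simp: scalar_prod_def ip lessThan_atLeast0)
  also have "det \<dots> = gram"
  proof -
    have 1: "mat p p (\<lambda>(i, j). ip (P i) (P j)) = 1\<^sub>m p"
      by (rule eq_matI) (auto simp: P_def V_orth)
    have 2: "(\<lambda>(i, j). ip (P (p + i)) (P (p + j))) = (\<lambda>(i, j). ip (F (p + i)) (F (p + j)))"
      by (simp add: P_def)
    show ?thesis
      using det_block_upper_triangular[of p "DIM('a) - p" "\<lambda>i j. ip (P i) (P j)"] pq
      by (simp add: gram_def 1 2)
        (simp add: P_def ip_commute[of "F _" "V _"] V_perp F_tan)
  qed
  finally show ?thesis .
qed

end

section \<open>Components of a tangent multivector\<close>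

text \<open>Cauchy--Binet with both factors equal; index sets of the wrong size contribute zero by
  the default value in \<open>wedge_vec\<close>.\<close>

lemma sum_wedge_vec_square:
  fixes b w :: "nat \<Rightarrow> 'a::euclidean_space"
  shows "(\<Sum>K\<in>Pow {..<DIM('a)}. (wedge_vec k b w K)\<^sup>2) =
    det (mat k k (\<lambda>(i, j). \<Sum>l<DIM('a). dual_basis b l (w i) * dual_basis b l (w j)))"
proof -
  have "(\<Sum>K\<in>Pow {..<DIM('a)}. (wedge_vec k b w K)\<^sup>2) =
    (\<Sum>K | K \<subseteq> {..<DIM('a)} \<and> card K = k. (wedge_vec k b w K)\<^sup>2)"
    by (rule sum.mono_neutral_right) (auto simp: wedge_vec_def)
  also have "\<dots> = (\<Sum>K | K \<subseteq> {..<DIM('a)} \<and> card K = k.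
       det (mat k k (\<lambda>(i, j). dual_basis b (sorted_list_of_set K ! i) (w j))) *
       det (mat k k (\<lambda>(i, j). dual_basis b (sorted_list_of_set K ! i) (w j))))"
    by (rule sum.cong) (auto simp: wedge_vec_def wedge_form_def power2_eq_square)
  also have "\<dots> = det (mat k k (\<lambda>(i, j). \<Sum>l<DIM('a). dual_basis b l (w i) * dual_basis b l (w j)))"
    by (rule cauchy_binet[symmetric])
  finally show ?thesis .
qed

text \<open>Ensures that the selected rows come in two blocks, horizontal ones first and then all
  vertical ones.\<close>

lemma sorted_list_of_set_append_upt:
  assumes K: "K \<subseteq> {..<n}" "{q..<n} \<subseteq> K"
  shows "sorted_list_of_set K = sorted_list_of_set (K \<inter> {..<q}) @ [q..<n]"
proof -
  have fin: "finite K" using K(1) finite_subset by blast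
  have "sorted_list_of_set (set (sorted_list_of_set (K \<inter> {..<q}) @ [q..<n])) =
    sorted_list_of_set (K \<inter> {..<q}) @ [q..<n]"
    using fin by (intro sorted_list_of_set.idem_if_sorted_distinct) (auto simp: sorted_append)
  also have "set (sorted_list_of_set (K \<inter> {..<q}) @ [q..<n]) = K"
    using fin K by (auto simp: set_eq_iff)
  finally show ?thesis .
qed

context adapted_data
begin

lemma sum_wedge_F_square:
  "(\<Sum>K\<in>Pow {..<DIM('a)}. (wedge_vec (DIM('a) - p) E (\<lambda>l. F (p + l)) K)\<^sup>2) = gram"
  unfolding sum_wedge_vec_square gram_def ip ..

lemma wedge_vec_tangent:
  assumes "\<And>j. j < DIM('a) - p \<Longrightarrow> w j \<in> T"
  shows "wedge_vec (DIM('a) - p) E w K = tcoef w * wedge_vec (DIM('a) - p) E (\<lambda>l. F (p + l)) K"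
  unfolding wedge_vec_def
  using wedge_form_tangent[of "\<lambda>i. dual_basis E (sorted_list_of_set K ! i)" w] assms
    dual_basis_linear[OF E] by simp

text \<open>The component is a block triangular determinant: horizontal frame vectors have no
  vertical coordinates, and the vertical block is the identity because each vertical
  \<open>F j\<close> differs from \<open>E j\<close> only horizontally.\<close>

lemma wedge_F_vertical:
  assumes K: "K \<subseteq> {..<DIM('a)}" "card K = DIM('a) - p" "{q..<DIM('a)} \<subseteq> K"
  shows "wedge_vec (DIM('a) - p) E (\<lambda>l. F (p + l)) K =
    det (mat (q - p) (q - p) (\<lambda>(i, j). dual_basis E (sorted_list_of_set (K \<inter> {..<q}) ! i) (F (p + j))))"
proof -
  have "K = (K \<inter> {..<q}) \<union> {q..<DIM('a)}" using K by auto
  then have "card K = card (K \<inter> {..<q}) + card {q..<DIM('a)}"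
    using card_Un_disjoint[of "K \<inter> {..<q}" "{q..<DIM('a)}"] by fastforce
  then have len: "card (K \<inter> {..<q}) = q - p"
    using K pq by simp
  let ?M = "\<lambda>i j. dual_basis E ((sorted_list_of_set (K \<inter> {..<q}) @ [q..<DIM('a)]) ! i) (F (p + j))"
  have m: "DIM('a) - p = (q - p) + (DIM('a) - q)" using pq by simp
  have "wedge_vec (DIM('a) - p) E (\<lambda>l. F (p + l)) K =
    det (mat (DIM('a) - p) (DIM('a) - p) (\<lambda>(i, j). ?M i j))"
    using K by (simp add: wedge_vec_def wedge_form_def sorted_list_of_set_append_upt)
  also have "\<dots> = det (mat (q - p) (q - p) (\<lambda>(i, j). ?M i j)) *
    det (mat (DIM('a) - q) (DIM('a) - q) (\<lambda>(i, j). ?M ((q - p) + i) ((q - p) + j)))"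
    unfolding m by (rule det_block_upper_triangular) (use pq in \<open>auto simp: nth_append len intro!: F_hor\<close>)
  also have "mat (DIM('a) - q) (DIM('a) - q) (\<lambda>(i, j). ?M ((q - p) + i) ((q - p) + j)) = 1\<^sub>m (DIM('a) - q)"
    by (rule eq_matI) (use pq in \<open>auto simp: nth_append len F_ver\<close>)
  also have "mat (q - p) (q - p) (\<lambda>(i, j). ?M i j) =
    mat (q - p) (q - p) (\<lambda>(i, j). dual_basis E (sorted_list_of_set (K \<inter> {..<q}) ! i) (F (p + j)))"
    by (rule eq_matI) (auto simp: nth_append len)
  finally show ?thesis by simp
qed

text \<open>Such \<open>K\<close> correspond to their horizontal parts, of size
  \<open>q - p\<close>. Cauchy--Binet inside the horizontal layer then gives the Gram determinant of
  the orthonormal vectors \<open>F p\<close>, ..., \<open>F (q - 1)\<close>.\<close>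

lemma sum_wedge_F_vertical_square:
  "(\<Sum>K | K \<subseteq> {..<DIM('a)} \<and> card K = DIM('a) - p \<and> {q..<DIM('a)} \<subseteq> K.
      (wedge_vec (DIM('a) - p) E (\<lambda>l. F (p + l)) K)\<^sup>2) = 1"
proof -
  let ?D = "\<lambda>L. det (mat (q - p) (q - p) (\<lambda>(i, j). dual_basis E (sorted_list_of_set L ! i) (F (p + j))))"
  have "(\<Sum>K | K \<subseteq> {..<DIM('a)} \<and> card K = DIM('a) - p \<and> {q..<DIM('a)} \<subseteq> K.
      (wedge_vec (DIM('a) - p) E (\<lambda>l. F (p + l)) K)\<^sup>2) =
    (\<Sum>L | L \<subseteq> {..<q} \<and> card L = q - p. (?D L)\<^sup>2)"
  proof (rule sum.reindex_bij_witness[where i = "\<lambda>L. L \<union> {q..<DIM('a)}" and j = "\<lambda>K. K \<inter> {..<q}"])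
    fix K assume K: "K \<in> {K. K \<subseteq> {..<DIM('a)} \<and> card K = DIM('a) - p \<and> {q..<DIM('a)} \<subseteq> K}"
    then show eq: "K \<inter> {..<q} \<union> {q..<DIM('a)} = K" by auto
    have "card (K \<inter> {..<q} \<union> {q..<DIM('a)}) = card (K \<inter> {..<q}) + card {q..<DIM('a)}"
      by (rule card_Un_disjoint) auto
    then show "K \<inter> {..<q} \<in> {L. L \<subseteq> {..<q} \<and> card L = q - p}"
      using K pq unfolding eq by auto
    show "(?D (K \<inter> {..<q}))\<^sup>2 = (wedge_vec (DIM('a) - p) E (\<lambda>l. F (p + l)) K)\<^sup>2"
      using K by (simp add: wedge_F_vertical)
  next
    fix L assume L: "L \<in> {L. L \<subseteq> {..<q} \<and> card L = q - p}"
    then show "(L \<union> {q..<DIM('a)}) \<inter> {..<q} = L" by auto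
    have "card (L \<union> {q..<DIM('a)}) = card L + card {q..<DIM('a)}"
      using L by (intro card_Un_disjoint) (auto intro: finite_subset)
    then show "L \<union> {q..<DIM('a)} \<in> {K. K \<subseteq> {..<DIM('a)} \<and> card K = DIM('a) - p \<and> {q..<DIM('a)} \<subseteq> K}"
      using L pq by auto
  qed
  also have "\<dots> = det (mat (q - p) (q - p) (\<lambda>(i, j). \<Sum>k<q. dual_basis E k (F (p + i)) * dual_basis E k (F (p + j))))"
    by (simp add: cauchy_binet[where A = "\<lambda>l i. dual_basis E l (F (p + i))" and B = "\<lambda>l i. dual_basis E l (F (p + i))"]
        power2_eq_square)
  also have "mat (q - p) (q - p) (\<lambda>(i, j). \<Sum>k<q. dual_basis E k (F (p + i)) * dual_basis E k (F (p + j))) =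
    1\<^sub>m (q - p)"
  proof (rule eq_matI)
    fix i j assume "i < dim_row (1\<^sub>m (q - p) :: real mat)" "j < dim_col (1\<^sub>m (q - p) :: real mat)"
    then have ij: "p + i < q" "p + j < q" "i < q - p" "j < q - p" by auto
    \<comment> \<open>Horizontal vectors have zero coordinates from \<open>q\<close> on, so the
      truncated sum is the full scalar product.\<close>
    have "(\<Sum>k<q. dual_basis E k (F (p + i)) * dual_basis E k (F (p + j))) = ip (F (p + i)) (F (p + j))"
      unfolding ip by (rule sum.mono_neutral_left) (use ij pq F_hor in auto)
    then show "mat (q - p) (q - p) (\<lambda>(i, j). \<Sum>k<q. dual_basis E k (F (p + i)) * dual_basis E k (F (p + j))) $$ (i, j) =
      1\<^sub>m (q - p) $$ (i, j)"
      using ij by (simp add: F_orth)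
  qed auto
  finally show ?thesis by simp
qed

text \<open>The unit norm gives \<open>1 = (tcoef w)^2 * gram\<close>, the part selected by
  \<open>D\<close> has squared norm \<open>(tcoef w)^2\<close>, and the squared volume is
  \<open>gram\<close>. Hence the product squares to one, and it is nonnegative. The predicate
  \<open>D\<close> stands for having maximal degree.\<close>

lemma density_volume:
  assumes w: "\<And>j. j < DIM('a) - p \<Longrightarrow> w j \<in> T"
    and t: "t = wedge_vec (DIM('a) - p) E w" "mv_norm DIM('a) t = 1"
    and D: "\<And>K. K \<subseteq> {..<DIM('a)} \<Longrightarrow> card K = DIM('a) - p \<Longrightarrow> D K \<longleftrightarrow> {q..<DIM('a)} \<subseteq> K"
  shows "mv_norm DIM('a) (\<lambda>K. if D K then t K else 0) * \<bar>wedge_form DIM('a) (dual_basis E) P\<bar> = 1"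
proof -
  let ?W = "wedge_vec (DIM('a) - p) E (\<lambda>l. F (p + l))"
  have tK: "t K = tcoef w * ?W K" for K
    unfolding t(1) by (rule wedge_vec_tangent[OF w])
  have "1 = (tcoef w)\<^sup>2 * gram"
    using t(2) by (simp add: mv_norm_def tK power_mult_distrib sum_wedge_F_square
        flip: sum_distrib_left)
  moreover have "(mv_norm DIM('a) (\<lambda>K. if D K then t K else 0))\<^sup>2 = (tcoef w)\<^sup>2"
  proof -
    have "(mv_norm DIM('a) (\<lambda>K. if D K then t K else 0))\<^sup>2 =
      (\<Sum>K\<in>Pow {..<DIM('a)}. (if D K then t K else 0)\<^sup>2)"
      by (simp add: mv_norm_def sum_nonneg)
    also have "\<dots> = (\<Sum>K | K \<subseteq> {..<DIM('a)} \<and> card K = DIM('a) - p \<and> {q..<DIM('a)} \<subseteq> K. (t K)\<^sup>2)"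
      by (rule sum.mono_neutral_cong_right) (auto simp: D t(1) wedge_vec_def)
    also have "\<dots> = (tcoef w)\<^sup>2"
      by (simp add: tK power_mult_distrib sum_wedge_F_vertical_square flip: sum_distrib_left)
    finally show ?thesis .
  qed
  ultimately have "(mv_norm DIM('a) (\<lambda>K. if D K then t K else 0) * \<bar>wedge_form DIM('a) (dual_basis E) P\<bar>)\<^sup>2 = 1"
    by (simp add: power_mult_distrib volume_square)
  moreover have "mv_norm DIM('a) (\<lambda>K. if D K then t K else 0) \<ge> 0"
    by (simp add: mv_norm_def sum_nonneg)
  ultimately show ?thesis
    by (simp add: power2_eq_1_iff) (smt (verit) abs_ge_zero mult_nonneg_nonneg)
qed

end

section \<open>Left-invariant frames and degrees\<close>

text \<open>A maximal independent subset of the image has as many elements as the index set, which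
  leaves room neither for repetitions nor for dependent members.\<close>

lemma (in vector_space) independent_family_of_dim:
  assumes "finite I" "dim (span (b ` I)) = card I"
  shows "inj_on b I \<and> independent (b ` I)"
proof -
  obtain B where B: "B \<subseteq> b ` I" "independent B" "b ` I \<subseteq> span B"
    by (rule maximal_independent_subset)
  then have "span B = span (b ` I)"
    by (simp add: span_mono span_minimal subset_antisym)
  then have "card B = card I"
    using dim_eq_card[of B "b ` I"] B(2) assms(2) by simp
  moreover have "card B \<le> card (b ` I)" "card (b ` I) \<le> card I"
    using B(1) assms(1) by (auto intro: card_mono card_image_le)
  ultimately have card: "card B = card (b ` I)" "card (b ` I) = card I"
    by auto
  have "B = b ` I" by (rule card_subset_eq[OF _ B(1) card(1)]) (use assms(1) in simp)
  then show ?thesis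
    using B(2) assms(1) card(2) by (auto intro: eq_card_imp_inj_on)
qed

lemma sum_fun_apply: "(\<Sum>i\<in>I. X i) x = (\<Sum>i\<in>I. X i x)"
  by (induction I rule: infinite_finite_induct) auto

text \<open>The block sizes \<open>ld\<close> are arbitrary, so that sums over blocks are available
  before the sizes are known to add up to the dimension.\<close>

definition layer_indices :: "(nat \<Rightarrow> nat) \<Rightarrow> nat \<Rightarrow> nat set" where
  "layer_indices ld j = {\<Sum>k\<in>{1..<j}. ld k ..< \<Sum>k\<in>{1..j}. ld k}"

lemma finite_layer_indices [simp]: "finite (layer_indices ld j)"
  by (simp add: layer_indices_def)

lemma sum_layer_indices:
  fixes h :: "nat \<Rightarrow> 'a::comm_monoid_add"
  shows "sum h {..<\<Sum>k\<in>{1..s}. ld k} = (\<Sum>j\<in>{1..s}. sum h (layer_indices ld j))"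
proof (induction s)
  case (Suc s)
  have "sum h {..<\<Sum>k\<in>{1..Suc s}. ld k} =
    sum h {0..<\<Sum>k\<in>{1..s}. ld k} + sum h {\<Sum>k\<in>{1..s}. ld k..<\<Sum>k\<in>{1..Suc s}. ld k}"
    unfolding lessThan_atLeast0 by (rule sum.atLeastLessThan_concat[symmetric]) auto
  also have "{\<Sum>k\<in>{1..s}. ld k..<\<Sum>k\<in>{1..Suc s}. ld k} = layer_indices ld (Suc s)"
    by (simp add: layer_indices_def atLeastLessThanSuc_atLeastAtMost)
  also have "sum h {0..<\<Sum>k\<in>{1..s}. ld k} = (\<Sum>j\<in>{1..s}. sum h (layer_indices ld j))"
    using Suc.IH by (simp add: lessThan_atLeast0)
  finally show ?case by simp
qed simp

lemma layer_indices_cover: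
  "{..<\<Sum>k\<in>{1..s}. ld k} = (\<Union>j\<in>{1..s}. layer_indices ld j)"
proof (induction s)
  case (Suc s)
  have "{..<\<Sum>k\<in>{1..Suc s}. ld k} = {..<\<Sum>k\<in>{1..s}. ld k} \<union> layer_indices ld (Suc s)"
    by (auto simp: layer_indices_def atLeastLessThanSuc_atLeastAtMost)
  then show ?case
    unfolding Suc.IH by (simp add: atLeastAtMostSuc_conv Un_commute)
qed simp

lemma card_layer_indices:
  assumes "1 \<le> j"
  shows "card (layer_indices ld j) = ld j"
proof -
  have "{1..j} = insert j {1..<j}" using assms by auto
  then show ?thesis by (simp add: layer_indices_def)
qed

section \<open>Left-invariant fields and their scalar product\<close>

locale stratified_basis =
  fixes G :: "('g::{t2_space, second_countable_topology}, 'a::euclidean_space) stratified"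
    and e :: "nat \<Rightarrow> 'g \<Rightarrow> 'a"
  assumes strat: "stratified_group G" and basis: "adapted_basis G e"
begin

lemma span_e: "field_space.span (e ` {..<DIM('a)}) = lie_alg G"
  using basis by (simp add: adapted_basis_def)

lemma e_orth: "i < DIM('a) \<Longrightarrow> j < DIM('a) \<Longrightarrow> sprod G (e i) (e j) = (if i = j then 1 else 0)"
  using basis by (simp add: adapted_basis_def)

lemma span_layer: "j \<in> {1..step G} \<Longrightarrow>
    field_space.span (e ` layer_indices (layer_dim G) j) = layer G j"
  using basis by (simp add: adapted_basis_def layer_indices_def)

lemma subspace_lie_alg: "field_space.subspace (lie_alg G)"
  using field_space.subspace_span[of "e ` {..<DIM('a)}"] by (simp add: span_e)

lemma e_lie_alg: "i < DIM('a) \<Longrightarrow> e i \<in> lie_alg G"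
  unfolding span_e[symmetric] by (intro field_space.span_base) auto

lemma lie_alg_comb: "(\<Sum>i<DIM('a). field_scale (c i) (e i)) \<in> lie_alg G"
  by (intro field_space.subspace_sum[OF subspace_lie_alg] field_space.subspace_scale[OF subspace_lie_alg] e_lie_alg) auto

lemma comb_apply: "(\<Sum>i\<in>I. field_scale (c i) (e i)) x = (\<Sum>i\<in>I. c i *\<^sub>R e i x)"
  by (simp add: sum_fun_apply field_scale_def)

lemma sprod_linear: "X \<in> lie_alg G \<Longrightarrow> Y \<in> lie_alg G \<Longrightarrow> Z \<in> lie_alg G \<Longrightarrow>
    sprod G (field_scale a X + field_scale b Y) Z = a * sprod G X Z + b * sprod G Y Z"
  and sprod_commute: "X \<in> lie_alg G \<Longrightarrow> Y \<in> lie_alg G \<Longrightarrow> sprod G X Y = sprod G Y X"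
  using strat by (auto simp: stratified_group_def stratified_sprod_def)

lemma sprod_zero: "Z \<in> lie_alg G \<Longrightarrow> sprod G 0 Z = 0"
  using sprod_linear[of Z Z Z 0 0] by simp

lemma sprod_sum:
  assumes "finite I" "\<And>i. i \<in> I \<Longrightarrow> X i \<in> lie_alg G" "Z \<in> lie_alg G"
  shows "sprod G (\<Sum>i\<in>I. field_scale (c i) (X i)) Z = (\<Sum>i\<in>I. c i * sprod G (X i) Z)"
  using assms
proof (induction I)
  case (insert i I)
  have "(\<Sum>i\<in>I. field_scale (c i) (X i)) \<in> lie_alg G"
    using insert.prems
    by (intro field_space.subspace_sum[OF subspace_lie_alg] field_space.subspace_scale[OF subspace_lie_alg]) auto
  then have *: "sprod G (field_scale (c i) (X i) + (\<Sum>i\<in>I. field_scale (c i) (X i))) Z =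
      c i * sprod G (X i) Z + sprod G (\<Sum>i\<in>I. field_scale (c i) (X i)) Z"
    using sprod_linear[of "X i" "\<Sum>i\<in>I. field_scale (c i) (X i)" Z "c i" 1] insert.prems by simp
  show ?case
    unfolding sum.insert[OF insert.hyps] * using insert.IH insert.prems by simp
qed (simp add: sprod_zero)

lemma sprod_comb:
  "sprod G (\<Sum>i<DIM('a). field_scale (c i) (e i)) (\<Sum>i<DIM('a). field_scale (d i) (e i)) =
    (\<Sum>i<DIM('a). c i * d i)"
proof -
  have *: "sprod G (e i) (\<Sum>i<DIM('a). field_scale (d i) (e i)) = d i" if "i < DIM('a)" for i
  proof -
    have "sprod G (\<Sum>i<DIM('a). field_scale (d i) (e i)) (e i) = (\<Sum>j<DIM('a). d j * sprod G (e j) (e i))"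
      by (rule sprod_sum) (auto simp: e_lie_alg that)
    also have "\<dots> = (\<Sum>j<DIM('a). if j = i then d i else 0)"
      by (rule sum.cong) (auto simp: e_orth that)
    also have "\<dots> = d i" using that by simp
    finally show ?thesis
      using sprod_commute[OF e_lie_alg[OF that] lie_alg_comb[of d]] by simp
  qed
  show ?thesis
    by (subst sprod_sum) (auto simp: e_lie_alg lie_alg_comb *)
qed

text \<open>The scalar product of the combination with itself is the sum of the squared
  coefficients.\<close>

lemma comb_eq_zero:
  assumes "(\<Sum>i<DIM('a). field_scale (c i) (e i)) = 0" "i < DIM('a)"
  shows "c i = 0"
proof -
  have "(\<Sum>i<DIM('a). c i * c i) = 0"
    using sprod_comb[of c c] lie_alg_comb[of c] by (simp add: assms(1) sprod_zero)
  then show ?thesis using assms(2) by (simp add: sum_nonneg_eq_0_iff)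
qed

text \<open>Left translation by \<open>y\<close> times the inverse of \<open>x\<close> carries the
  value at \<open>x\<close> to the value at \<open>y\<close>, so one value determines a
  left-invariant field.\<close>

lemma lie_alg_eqI:
  assumes "X \<in> lie_alg G" "Y \<in> lie_alg G" "X x = Y x"
  shows "X = Y"
proof
  fix y
  have G: "group G" "carrier G = UNIV"
    using strat by (auto simp: stratified_group_def lie_group_def)
  interpret group G by (rule G)
  have y: "(y \<otimes>\<^bsub>G\<^esub> inv\<^bsub>G\<^esub> x) \<otimes>\<^bsub>G\<^esub> x = y"
    by (simp add: m_assoc G(2))
  have "tangent_map (atlas G) (\<lambda>z. (y \<otimes>\<^bsub>G\<^esub> inv\<^bsub>G\<^esub> x) \<otimes>\<^bsub>G\<^esub> z) x (Z x) = Z y"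
    if "Z \<in> lie_alg G" for Z
  proof -
    have "\<forall>g x. tangent_map (atlas G) (\<lambda>y. g \<otimes>\<^bsub>G\<^esub> y) x (Z x) = Z (g \<otimes>\<^bsub>G\<^esub> x)"
      using that by (simp add: lie_alg_def)
    then show ?thesis by (simp add: y)
  qed
  from this[OF assms(1)] this[OF assms(2)] show "X y = Y y"
    by (simp add: assms(3))
qed

text \<open>A linear relation at one point extends to the whole group by left invariance, and the
  fields themselves are independent.\<close>

lemma frame_e: "frame (\<lambda>i. e i x)"
proof (rule frameI)
  fix c i assume "(\<Sum>i<DIM('a). c i *\<^sub>R e i x) = 0" and i: "i < DIM('a)"
  then have "(\<Sum>i<DIM('a). field_scale (c i) (e i)) x = 0 x"
    by (simp add: comb_apply)
  then have "(\<Sum>i<DIM('a). field_scale (c i) (e i)) = 0"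
    by (intro lie_alg_eqI lie_alg_comb field_space.subspace_0[OF subspace_lie_alg])
  then show "c i = 0" using i by (rule comb_eq_zero)
qed

lemma left_inv_ext_eq:
  "left_inv_ext G x \<xi> = (\<Sum>i<DIM('a). field_scale (dual_basis (\<lambda>i. e i x) i \<xi>) (e i))"
  unfolding left_inv_ext_def
proof (rule the_equality)
  show *: "(\<Sum>i<DIM('a). field_scale (dual_basis (\<lambda>i. e i x) i \<xi>) (e i)) \<in> lie_alg G \<and>
    (\<Sum>i<DIM('a). field_scale (dual_basis (\<lambda>i. e i x) i \<xi>) (e i)) x = \<xi>"
    using frame_expansion[OF frame_e[of x], of \<xi>] by (simp add: lie_alg_comb comb_apply)
  show "X = (\<Sum>i<DIM('a). field_scale (dual_basis (\<lambda>i. e i x) i \<xi>) (e i))"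
    if "X \<in> lie_alg G \<and> X x = \<xi>" for X
    using that * by (intro lie_alg_eqI[of _ _ x]) auto
qed

lemma riem_eq:
  "riem G x \<xi> \<eta> = (\<Sum>k<DIM('a). dual_basis (\<lambda>i. e i x) k \<xi> * dual_basis (\<lambda>i. e i x) k \<eta>)"
  unfolding riem_def left_inv_ext_eq by (rule sprod_comb)

section \<open>Layers, horizontal vectors and degrees\<close>

lemma stratification_G: "stratification G"
  using strat by (simp add: stratified_group_def)

text \<open>Without layers the Lie algebra would be the span of the empty set, whereas
  \<open>e 0\<close> has unit length.\<close>

lemma step_pos: "1 \<le> step G"
proof (rule ccontr)
  assume "\<not> 1 \<le> step G"
  then have "lie_alg G = {0}"
    using stratification_G by (auto simp: stratification_def)
  then have "e 0 = 0" using e_lie_alg[of 0] by simp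
  then show False using e_orth[of 0 0] sprod_zero[OF e_lie_alg[of 0]] by simp
qed

lemma independent_layer:
  assumes "j \<in> {1..step G}"
  shows "inj_on e (layer_indices (layer_dim G) j) \<and>
    field_space.independent (e ` layer_indices (layer_dim G) j)"
  by (rule field_space.independent_family_of_dim)
    (use assms in \<open>auto simp: span_layer card_layer_indices layer_dim_def[of G]\<close>)

text \<open>The fields \<open>e i\<close> with \<open>i\<close> below the sum of the layer
  dimensions are independent, because the sum of the layers is direct and each block is independent;
  they also span the Lie algebra. The first \<open>DIM('a)\<close> fields form a basis too, so the
  two counts agree.\<close>

lemma sum_layer_dim: "(\<Sum>j\<in>{1..step G}. layer_dim G j) = DIM('a)"
proof -
  let ?N = "\<Sum>j\<in>{1..step G}. layer_dim G j"
  let ?B = "layer_indices (layer_dim G)"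
  have "inj_on e {..<?N} \<and> field_space.independent (e ` {..<?N})"
    unfolding field_space.independent_family_iff[OF finite_lessThan]
  proof (intro allI impI ballI)
    fix c i assume c: "(\<Sum>i<?N. field_scale (c i) (e i)) = 0" and i: "i \<in> {..<?N}"
    \<comment> \<open>The component in layer \<open>j\<close> of the vanishing combination;
      directness of the stratification makes each component zero.\<close>
    define X where "X j = (\<Sum>i\<in>?B j. field_scale (c i) (e i))" for j
    have "(\<Sum>j\<in>{1..step G}. X j) = 0"
      using c by (simp only: X_def sum_layer_indices)
    moreover have "X j \<in> layer G j" if "j \<in> {1..step G}" for j
      unfolding X_def span_layer[OF that, symmetric]
      by (intro field_space.span_sum field_space.span_scale field_space.span_base) auto
    moreover have "(\<forall>j\<in>{1..step G}. X j \<in> layer G j) \<and> (\<Sum>j\<in>{1..step G}. X j) = 0 \<longrightarrow>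
        (\<forall>j\<in>{1..step G}. X j = 0)"
      using stratification_G unfolding stratification_def by (elim conjE) (erule spec)
    ultimately have X0: "X j = 0" if "j \<in> {1..step G}" for j
      using that by blast
    obtain j where j: "j \<in> {1..step G}" "i \<in> ?B j"
      using i layer_indices_cover[of "layer_dim G" "step G"] by blast
    have "\<forall>i\<in>?B j. c i = 0"
      using independent_layer[OF j(1)] X0[OF j(1), unfolded X_def]
      unfolding field_space.independent_family_iff[OF finite_layer_indices]
      by (elim allE[of _ c]) (rule mp)
    then show "c i = 0" using j(2) by blast
  qed
  moreover have "field_space.span (e ` {..<?N}) = lie_alg G"
  proof -
    have "field_space.span (e ` {..<?N}) = field_space.span (\<Union>j\<in>{1..step G}. e ` ?B j)"
      by (simp only: layer_indices_cover image_UN)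
    also have "\<dots> = field_space.span (\<Union>j\<in>{1..step G}. layer G j)"
    proof (rule subset_antisym)
      have "e ` ?B j \<subseteq> layer G j" if "j \<in> {1..step G}" for j
        unfolding span_layer[OF that, symmetric] by (rule field_space.span_superset)
      then show "field_space.span (\<Union>j\<in>{1..step G}. e ` ?B j) \<subseteq> field_space.span (\<Union>j\<in>{1..step G}. layer G j)"
        by (intro field_space.span_mono) blast
      have "layer G j \<subseteq> field_space.span (\<Union>j\<in>{1..step G}. e ` ?B j)" if "j \<in> {1..step G}" for j
        unfolding span_layer[OF that, symmetric] using that by (intro field_space.span_mono) blast
      then show "field_space.span (\<Union>j\<in>{1..step G}. layer G j) \<subseteq> field_space.span (\<Union>j\<in>{1..step G}. e ` ?B j)"
        by (intro field_space.span_minimal UN_least field_space.subspace_span)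
    qed
    also have "\<dots> = lie_alg G"
      using stratification_G unfolding stratification_def by (elim conjE)
    finally show ?thesis .
  qed
  moreover have "inj_on e {..<DIM('a)} \<and> field_space.independent (e ` {..<DIM('a)})"
    unfolding field_space.independent_family_iff[OF finite_lessThan]
    using comb_eq_zero by auto
  ultimately show ?thesis
    using field_space.dim_eq_card[of "e ` {..<?N}" "lie_alg G"]
      field_space.dim_eq_card[of "e ` {..<DIM('a)}" "lie_alg G"] span_e
      field_space.span_eq_iff[THEN iffD2, OF subspace_lie_alg]
    by (simp add: card_image)
qed

lemma layer_indices_union: "(\<Union>j\<in>{1..step G}. layer_indices (layer_dim G) j) = {..<DIM('a)}"
  by (simp only: layer_indices_cover[symmetric] sum_layer_dim)

lemma layer_dim_1_le: "layer_dim G 1 \<le> DIM('a)"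
  unfolding sum_layer_dim[symmetric] using step_pos by (intro member_le_sum) auto

lemma layer_indices_1: "layer_indices (layer_dim G) 1 = {..<layer_dim G 1}"
  by (simp add: layer_indices_def lessThan_atLeast0)

lemma horizontal_eq: "horizontal G x = span ((\<lambda>i. e i x) ` {..<layer_dim G 1})"
proof -
  have "\<xi> \<in> horizontal G x \<longleftrightarrow> \<xi> \<in> span ((\<lambda>i. e i x) ` {..<layer_dim G 1})" for \<xi>
  proof -
    have layer: "layer G 1 = field_space.span (e ` {..<layer_dim G 1})"
      using span_layer[of 1] step_pos by (simp only: layer_indices_1) simp
    have "\<xi> \<in> horizontal G x \<longleftrightarrow> (\<exists>X \<in> layer G 1. \<xi> = X x)"
      unfolding horizontal_def by blast
    also have "\<dots> \<longleftrightarrow> (\<exists>c. \<xi> = (\<Sum>i<layer_dim G 1. field_scale (c i) (e i)) x)"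
      unfolding layer Bex_def field_space.span_family[OF finite_lessThan] by blast
    finally show ?thesis
      by (simp add: comb_apply real_vector.span_family)
  qed
  then show ?thesis by blast
qed

lemma dual_basis_horizontal:
  assumes "\<xi> \<in> horizontal G x" "layer_dim G 1 \<le> k" "k < DIM('a)"
  shows "dual_basis (\<lambda>i. e i x) k \<xi> = 0"
proof -
  obtain c where "\<xi> = (\<Sum>i<layer_dim G 1. c i *\<^sub>R e i x)"
    using assms(1) unfolding horizontal_eq real_vector.span_family[OF finite_lessThan] by blast
  then show ?thesis
    using assms(2,3) layer_dim_1_le
    by (simp add: linear_sum[OF dual_basis_linear[OF frame_e]] linear_scale[OF dual_basis_linear[OF frame_e]]
        dual_basis_basis[OF frame_e])
qed

text \<open>The degree is well defined: a basis field lying in two different layers would be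
  orthogonal to itself.\<close>

lemma field_degree_e:
  assumes "j \<in> {1..step G}" "i \<in> layer_indices (layer_dim G) j"
  shows "field_degree G (e i) = j"
  unfolding field_degree_def
proof (rule the_equality)
  have "i \<in> (\<Union>j\<in>{1..step G}. layer_indices (layer_dim G) j)" using assms by blast
  then have i: "i < DIM('a)" unfolding layer_indices_union by simp
  have layer: "e i \<in> layer G j"
    unfolding span_layer[OF assms(1), symmetric] using assms(2) by (intro field_space.span_base) auto
  with assms(1) show "j \<in> {1..step G} \<and> e i \<in> layer G j" by blast
  have orth: "\<forall>i\<in>{1..step G}. \<forall>j\<in>{1..step G}. i \<noteq> j \<longrightarrow>
        (\<forall>X\<in>layer G i. \<forall>Y\<in>layer G j. sprod G X Y = 0)"
    using strat by (simp add: stratified_group_def stratified_sprod_def)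
  show "k = j" if k: "k \<in> {1..step G} \<and> e i \<in> layer G k" for k
  proof (rule ccontr)
    assume "k \<noteq> j"
    then have "sprod G (e i) (e i) = 0" using orth k layer assms(1) by blast
    then show False using e_orth[OF i i] by simp
  qed
qed

lemma field_degree_e_horizontal: "i < layer_dim G 1 \<Longrightarrow> field_degree G (e i) = 1"
  using field_degree_e[of 1 i] step_pos by (simp add: layer_indices_1[simplified])

lemma field_degree_e_vertical:
  assumes "layer_dim G 1 \<le> i" "i < DIM('a)"
  shows "2 \<le> field_degree G (e i)"
proof -
  have "i \<in> (\<Union>j\<in>{1..step G}. layer_indices (layer_dim G) j)"
    unfolding layer_indices_union using assms(2) by simp
  then obtain j where j: "j \<in> {1..step G}" "i \<in> layer_indices (layer_dim G) j" by blast
  have "j \<noteq> 1"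
  proof
    assume "j = 1"
    then have "i \<in> {..<layer_dim G 1}" using j(2) by (simp only: layer_indices_1)
    then show False using assms(1) by simp
  qed
  then show ?thesis using j(1) unfolding field_degree_e[OF j] by simp
qed

lemma hausdorff_dim_eq: "hausdorff_dim G = (\<Sum>i<DIM('a). field_degree G (e i))"
proof -
  have "(\<Sum>i<DIM('a). field_degree G (e i)) =
    (\<Sum>j\<in>{1..step G}. \<Sum>i\<in>layer_indices (layer_dim G) j. field_degree G (e i))"
    using sum_layer_indices[of "\<lambda>i. field_degree G (e i)" "layer_dim G" "step G"]
    by (simp only: sum_layer_dim)
  also have "\<dots> = (\<Sum>j\<in>{1..step G}. \<Sum>i\<in>layer_indices (layer_dim G) j. j)"
    by (intro sum.cong) (auto simp: field_degree_e)
  also have "\<dots> = hausdorff_dim G"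
    unfolding hausdorff_dim_def by (intro sum.cong) (auto simp: card_layer_indices)
  finally show ?thesis ..
qed

text \<open>The complement of \<open>K\<close> consists of \<open>p\<close> vectors of degree at least one, so that the degree of
  \<open>K\<close> is maximal iff they all are horizontal.\<close>

lemma degree_eq_iff:
  assumes p: "p \<le> DIM('a)" and K: "K \<subseteq> {..<DIM('a)}" "card K = DIM('a) - p"
  shows "(\<Sum>i\<in>K. field_degree G (e i)) = hausdorff_dim G - p \<longleftrightarrow> {layer_dim G 1..<DIM('a)} \<subseteq> K"
proof -
  let ?deg = "\<lambda>i. field_degree G (e i)"
  let ?C = "{..<DIM('a)} - K"
  have fin: "finite K" using K(1) finite_subset by blast
  have cardC: "card ?C = p" using K fin p by (simp add: card_Diff_subset)
  have Q: "hausdorff_dim G = sum ?deg K + sum ?deg ?C"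
    unfolding hausdorff_dim_eq using sum.subset_diff[OF K(1), of ?deg] by simp
  have deg1: "1 \<le> ?deg i" if "i \<in> ?C" for i
    using that field_degree_e_horizontal[of i] field_degree_e_vertical[of i]
    by (cases "i < layer_dim G 1") auto
  have C1: "sum (\<lambda>_. 1) ?C \<le> sum ?deg ?C" by (rule sum_mono) (rule deg1)
  show ?thesis
  proof
    assume "sum ?deg K = hausdorff_dim G - p"
    \<comment> \<open>The subtraction of \<open>p\<close> is not truncated, since the degrees over
      the complement add up to at least its cardinality \<open>p\<close>.\<close>
    then have eq: "sum ?deg ?C = sum (\<lambda>_. 1) ?C" using Q C1 cardC by simp
    show "{layer_dim G 1..<DIM('a)} \<subseteq> K"
    proof (rule ccontr)
      assume "\<not> ?thesis"
      then have "\<exists>i. layer_dim G 1 \<le> i \<and> i < DIM('a) \<and> i \<notin> K" by (auto simp: subset_eq)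
      then obtain i where i: "layer_dim G 1 \<le> i" "i < DIM('a)" "i \<notin> K" by blast
      \<comment> \<open>A single omitted vertical index, of degree at least two, makes the
        inequality strict.\<close>
      then have "sum (\<lambda>_. 1) ?C < sum ?deg ?C"
        using deg1 field_degree_e_vertical[of i] by (intro sum_strict_mono_ex1) (auto intro!: bexI[of _ i])
      then show False using eq by simp
    qed
  next
    assume "{layer_dim G 1..<DIM('a)} \<subseteq> K"
    then have "?deg i = 1" if "i \<in> ?C" for i
      using that by (intro field_degree_e_horizontal) (auto simp: subset_eq not_le[symmetric])
    then have "sum ?deg ?C = p" using cardC by simp
    then show "sum ?deg K = hausdorff_dim G - p" using Q by simp
  qed
qed

end

section \<open>Charts, densities and orientations\<close>

lemma smooth_on_differentiable:
  assumes "smooth_on S F" "u \<in> S"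
  shows "F differentiable (at u)"
proof -
  have "Ck_on (Suc 0) S F" using assms(1) unfolding smooth_on_def by blast
  then show ?thesis using assms(2) by simp
qed

lemma smooth_on_continuous_on: "smooth_on S F \<Longrightarrow> continuous_on S F"
  unfolding smooth_on_def using Ck_on.simps(1) by blast

lemma base_chart:
  assumes "smooth_atlas A"
  shows base_chart_in: "base_chart A x \<in> A" and base_chart_dom: "x \<in> fst (base_chart A x)"
proof -
  have "\<exists>c. c \<in> A \<and> x \<in> fst c"
    using assms unfolding smooth_atlas_def by (metis UNIV_I UN_E)
  then have "base_chart A x \<in> A \<and> x \<in> fst (base_chart A x)"
    unfolding base_chart_def by (rule someI_ex)
  then show "base_chart A x \<in> A" "x \<in> fst (base_chart A x)" by auto
qed

context
  fixes A :: "('g::topological_space, 'a::euclidean_space) chart set"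
  assumes A: "smooth_atlas A"
begin

lemma chart_homeomorphism:
  "c \<in> A \<Longrightarrow> homeomorphism (fst c) (snd c ` fst c) (snd c) (chart_inv c)"
  and chart_open: "c \<in> A \<Longrightarrow> open (fst c)" "c \<in> A \<Longrightarrow> open (snd c ` fst c)"
  using A by (auto simp: smooth_atlas_def)

lemma chart_inv_chart: "c \<in> A \<Longrightarrow> x \<in> fst c \<Longrightarrow> chart_inv c (snd c x) = x"
  using chart_homeomorphism by (meson homeomorphism_apply1)

lemma transition_differentiable:
  assumes "c \<in> A" "d \<in> A" "x \<in> fst c" "x \<in> fst d"
  shows "(snd d \<circ> chart_inv c) differentiable (at (snd c x))"
  using A assms unfolding smooth_atlas_def by (blast intro: smooth_on_differentiable)

lemma open_chart_overlap:
  assumes c: "c \<in> A" and "open W"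
  shows "open {u \<in> snd c ` fst c. chart_inv c u \<in> W}"
  using continuous_open_preimage[OF _ chart_open(2)[OF c] assms(2), of "chart_inv c"]
    chart_homeomorphism[OF c] by (simp add: homeomorphism_def vimage_def Int_def)

lemma to_chart_linear:
  assumes "c \<in> A" "x \<in> fst c"
  shows "linear (to_chart A c x)"
  unfolding to_chart_def
  using transition_differentiable[OF base_chart_in[OF A] assms(1) base_chart_dom[OF A] assms(2)]
  by (rule linear_frechet_derivative)

text \<open>The transition maps between \<open>c\<close> and the base chart are mutually inverse
  near the point, so by the chain rule \<open>from_chart\<close> is a left inverse of
  \<open>to_chart\<close>.\<close>

lemma to_chart_inj:
  assumes c: "c \<in> A" and x: "x \<in> fst c"
  shows "inj (to_chart A c x)"
proof -
  define b where "b = base_chart A x"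
  have b: "b \<in> A" "x \<in> fst b" using base_chart[OF A] by (auto simp: b_def)
  let ?g = "snd c \<circ> chart_inv b" and ?h = "snd b \<circ> chart_inv c"
  let ?S = "{u \<in> snd b ` fst b. chart_inv b u \<in> fst c}"
  have g: "(?g has_derivative to_chart A c x) (at (snd b x))"
    using transition_differentiable[OF b(1) c b(2) x]
    by (simp add: to_chart_def frechet_derivative_works flip: b_def)
  have "(?h has_derivative from_chart A c x) (at (snd c x))"
    using transition_differentiable[OF c b(1) x b(2)]
    by (simp add: from_chart_def frechet_derivative_works flip: b_def)
  then have h: "(?h has_derivative from_chart A c x) (at (?g (snd b x)))"
    using b by (simp add: chart_inv_chart)
  have "((?h \<circ> ?g) has_derivative (from_chart A c x \<circ> to_chart A c x)) (at (snd b x))"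
    by (rule diff_chain_at[OF g h])
  then have "(id has_derivative (from_chart A c x \<circ> to_chart A c x)) (at (snd b x))"
  proof (rule has_derivative_transform_within_open)
    show "open ?S" by (rule open_chart_overlap[OF b(1) chart_open(1)[OF c]])
    show "snd b x \<in> ?S" using b x by (auto simp: chart_inv_chart)
    show "(?h \<circ> ?g) u = id u" if "u \<in> ?S" for u
      using that b c by (auto simp: chart_inv_chart)
  qed
  then have "from_chart A c x \<circ> to_chart A c x = id"
    using has_derivative_unique has_derivative_id by blast
  then show ?thesis by (metis inj_on_id inj_on_imageI2)
qed

lemma smooth_field_continuous_field:
  assumes "smooth_field A W X" "c \<in> A"
  shows "continuous_on (fst c \<inter> W) (\<lambda>x. to_chart A c x (X x))"
proof -
  have "continuous_on (snd c ` (fst c \<inter> W)) (field_in_chart A c X)"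
    using assms by (auto simp: smooth_field_def intro: smooth_on_continuous_on)
  moreover have "continuous_on (fst c \<inter> W) (snd c)"
    using chart_homeomorphism[OF assms(2)] by (auto simp: homeomorphism_def intro: continuous_on_subset)
  ultimately have "continuous_on (fst c \<inter> W) (\<lambda>x. field_in_chart A c X (snd c x))"
    by (metis continuous_on_compose2 subset_refl)
  then show ?thesis
    by (rule continuous_on_eq) (simp add: field_in_chart_def chart_inv_chart assms(2))
qed

end

section \<open>Slice charts and densities\<close>

text \<open>The vector is the velocity of the coordinate line through \<open>x\<close> in the
  direction \<open>bs ! i\<close>, which stays in the slice and hence in \<open>M\<close> for small
  times.\<close>

lemma slice_chart_tangent:
  assumes A: "smooth_atlas A" and sl: "slice_chart A p M c bs"
    and x: "x \<in> M" "x \<in> fst c" and i: "i < length bs"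
  shows "from_chart A c x (bs ! i) \<in> tangent_space A M x"
proof -
  define b where "b = base_chart A x"
  let ?b = "bs ! i" and ?u = "snd c x"
  define \<gamma> where "\<gamma> t = chart_inv c (?u + t *\<^sub>R ?b)" for t :: real
  have cA: "smooth_atlas (insert c A)" and bs: "set bs \<subseteq> Basis"
    and slice: "snd c ` (M \<inter> fst c) = snd c ` fst c \<inter> span (set bs)"
    using sl by (auto simp: slice_chart_def)
  have b: "b \<in> insert c A" "x \<in> fst b" using base_chart[OF A] by (auto simp: b_def)
  have inv: "chart_inv c (snd c y) = y" if "y \<in> fst c" for y
    using chart_inv_chart[OF cA _ that] by simp
  have norm: "norm ?b = 1" using bs i by (simp add: subset_eq)
  \<comment> \<open>Tangent vectors are defined by curves inside the base chart, so the line must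
    remain in the overlap of both charts.\<close>
  let ?S = "{u \<in> snd c ` fst c. chart_inv c u \<in> fst b}"
  have "open ?S"
    by (rule open_chart_overlap[OF cA]) (use chart_open(1)[OF cA b(1)] in auto)
  moreover have "?u \<in> ?S" using x b inv by auto
  ultimately obtain r where r: "r > 0" "ball ?u r \<subseteq> ?S"
    by (meson openE)
  have \<gamma>: "\<gamma> t \<in> M \<inter> fst b" if "\<bar>t\<bar> < r" for t
  proof -
    have "?u + t *\<^sub>R ?b \<in> ball ?u r" using that norm by (simp add: dist_norm)
    then have S: "?u + t *\<^sub>R ?b \<in> ?S" using r(2) by blast
    have "?u \<in> span (set bs)" using x slice by blast
    then have "?u + t *\<^sub>R ?b \<in> span (set bs)"
      using i by (simp add: span_add span_scale span_base)
    then obtain y where "y \<in> M \<inter> fst c" "?u + t *\<^sub>R ?b = snd c y"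
      using S slice by blast
    then show ?thesis using S inv by (auto simp: \<gamma>_def)
  qed
  have "((snd b \<circ> chart_inv c) has_derivative from_chart A c x) (at ?u)"
    using transition_differentiable[OF cA insertI1 b(1) x(2) b(2)]
    by (simp add: from_chart_def frechet_derivative_works flip: b_def)
  then have D: "((snd b \<circ> chart_inv c) has_derivative from_chart A c x)
      (at (?u + 0 *\<^sub>R ?b) within range (\<lambda>t::real. ?u + t *\<^sub>R ?b))"
    by (simp only: scaleR_zero_left add_0_right) (rule has_derivative_at_withinI)
  have "((\<lambda>t::real. ?u + t *\<^sub>R ?b) has_vector_derivative ?b) (at 0)"
    by (auto intro!: derivative_eq_intros)
  from vector_derivative_diff_chain_within[OF this D] have "((snd b \<circ> chart_inv c \<circ> (\<lambda>t. ?u + t *\<^sub>R ?b)) has_vector_derivative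
      from_chart A c x ?b) (at 0)" .
  then have "((snd b \<circ> \<gamma>) has_vector_derivative from_chart A c x ?b) (at 0)"
    by (simp add: \<gamma>_def o_def)
  moreover have "\<gamma> 0 = x" using inv x(2) by (simp add: \<gamma>_def)
  ultimately show ?thesis
    unfolding tangent_space_def b_def[symmetric]
    by (intro CollectI exI[of _ \<gamma>] exI[of _ r] conjI allI impI r(1) \<gamma>)
qed

lemma has_form_density_mono:
  assumes "has_form_density A p M W \<mu> \<omega>" "U \<subseteq> W"
  shows "has_form_density A p M U \<mu> \<omega>"
  using assms unfolding has_form_density_def by blast

text \<open>The integrand evaluates a form only on coordinate vectors of slice charts, which are
  tangent to \<open>M\<close>; away from the image of \<open>E\<close> the indicator
  vanishes.\<close>

lemma has_form_density_cong:
  assumes A: "smooth_atlas A" and \<mu>: "sets \<mu> = sets (restrict_space borel M)"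
    and eq: "\<And>x w. x \<in> M \<inter> U \<Longrightarrow> (\<And>i. i < DIM('a) - p \<Longrightarrow> w i \<in> tangent_space A M x) \<Longrightarrow>
      \<bar>\<omega> x w\<bar> = \<bar>\<omega>' x w\<bar>"
    and dens: "has_form_density (A :: ('g::topological_space, 'a::euclidean_space) chart set) p M U \<mu> \<omega>"
  shows "has_form_density A p M U \<mu> \<omega>'"
  unfolding has_form_density_def
proof (intro allI impI ballI)
  fix c bs E
  assume c: "slice_chart A p M c bs \<and> fst c \<subseteq> U" and E: "E \<in> sets \<mu>" "E \<subseteq> fst c"
  have len: "length bs = DIM('a) - p" and cA: "smooth_atlas (insert c A)"
    using c by (auto simp: slice_chart_def)
  have EM: "E \<subseteq> M" using E(1) \<mu> by (auto simp: sets_restrict_space)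
  let ?I = "\<lambda>\<omega> u. ennreal \<bar>\<omega> (chart_inv c u) (\<lambda>i. from_chart A c (chart_inv c u) (bs ! i))\<bar>
    * indicator (snd c ` E) u"
  have "?I \<omega> u = ?I \<omega>' u" for u
  proof (cases "u \<in> snd c ` E")
    case True
    then obtain x where x: "x \<in> E" "u = snd c x" by blast
    then have inv: "chart_inv c u = x" using E(2) chart_inv_chart[OF cA insertI1] by auto
    have "from_chart A c x (bs ! i) \<in> tangent_space A M x" if "i < DIM('a) - p" for i
      using slice_chart_tangent[OF A, of p M c bs x i] c x E(2) EM that len by auto
    then have "\<bar>\<omega> x (\<lambda>i. from_chart A c x (bs ! i))\<bar> = \<bar>\<omega>' x (\<lambda>i. from_chart A c x (bs ! i))\<bar>"
      using eq[of x "\<lambda>i. from_chart A c x (bs ! i)"] x(1) E(2) EM c by blast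
    then show ?thesis by (simp only: inv)
  qed simp
  moreover have "emeasure \<mu> E = (\<integral>\<^sup>+u. ?I \<omega> u \<partial>lborel_on (set bs))"
    using dens c E unfolding has_form_density_def by blast
  ultimately show "emeasure \<mu> E = (\<integral>\<^sup>+u. ?I \<omega>' u \<partial>lborel_on (set bs))"
    by simp
qed

section \<open>Continuity of the orientation sign\<close>

lemma continuous_on_wedge_form:
  assumes "\<And>i j. i < k \<Longrightarrow> j < k \<Longrightarrow> continuous_on S (\<lambda>x. \<phi> i (w j x))"
  shows "continuous_on S (\<lambda>x. wedge_form k \<phi> (\<lambda>j. w j x))"
proof -
  have "wedge_form k \<phi> (\<lambda>j. w j x) =
    (\<Sum>p | p permutes {0..<k}. signof p * (\<Prod>i<k. \<phi> (p i) (w i x)))" for x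
  proof -
    have "p i < k" if "p permutes {0..<k}" "i < k" for p i
      using that permutes_in_image[of p "{0..<k}" i] by auto
    then show ?thesis
      unfolding wedge_form_def
      by (subst det_col[OF mat_carrier]) (auto intro!: sum.cong prod.cong)
  qed
  moreover have "p i < k" if "p permutes {0..<k}" "i < k" for p i
    using that permutes_in_image[of p "{0..<k}" i] by auto
  ultimately show ?thesis
    using assms by (auto intro!: continuous_intros)
qed

lemma wedge_form_frame:
  fixes b w :: "nat \<Rightarrow> 'a::euclidean_space"
  assumes "frame b" "\<And>i. i < DIM('a) \<Longrightarrow> linear (\<phi> i)"
  shows "wedge_form DIM('a) \<phi> w = wedge_form DIM('a) \<phi> b * wedge_form DIM('a) (dual_basis b) w"
proof -
  have "wedge_form DIM('a) \<phi> w =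
    wedge_form DIM('a) \<phi> (\<lambda>j. \<Sum>l<DIM('a). dual_basis b l (w j) *\<^sub>R b l)"
    using frame_expansion[OF assms(1)] by (intro wedge_form_cong) metis
  then show ?thesis
    by (simp only: wedge_form_linear_comb[OF assms(2)]) (simp add: wedge_form_def)
qed

lemma wedge_form_dual_basis_self:
  fixes b :: "nat \<Rightarrow> 'a::euclidean_space"
  assumes "frame b"
  shows "wedge_form DIM('a) (dual_basis b) b = 1"
proof -
  have "mat DIM('a) DIM('a) (\<lambda>(i, j). dual_basis b i (b j)) = 1\<^sub>m DIM('a)"
    by (rule eq_matI) (auto simp: dual_basis_basis[OF assms])
  then show ?thesis by (simp add: wedge_form_def)
qed

lemma ex_frame: "\<exists>b :: nat \<Rightarrow> 'a::euclidean_space. frame b"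
proof -
  obtain b :: "nat \<Rightarrow> 'a" where "bij_betw b {0..<DIM('a)} Basis"
    using ex_bij_betw_nat_finite finite_Basis by blast
  then have "frame b"
    by (simp add: frame_def bij_betw_def lessThan_atLeast0 independent_Basis)
  then show ?thesis by blast
qed

lemma frame_linear_image:
  fixes b :: "nat \<Rightarrow> 'a::euclidean_space" and L :: "'a \<Rightarrow> 'a"
  assumes b: "frame b" and L: "linear L" "inj L"
  shows "frame (\<lambda>i. L (b i))"
proof (rule frameI)
  fix c i assume "(\<Sum>i<DIM('a). c i *\<^sub>R L (b i)) = 0" and i: "i < DIM('a)"
  then have "L (\<Sum>i<DIM('a). c i *\<^sub>R b i) = L 0"
    by (simp add: linear_sum[OF L(1)] linear_scale[OF L(1)] linear_0[OF L(1)])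
  then have "(\<Sum>i<DIM('a). c i *\<^sub>R b i) = 0" using L(2) by (simp add: inj_eq)
  then show "c i = 0"
    using dual_basis_sum[OF b i, of c] linear_0[OF dual_basis_linear[OF b]] by simp
qed

text \<open>In a chart, the determinant of the fields \<open>X j\<close> with respect to the frame \<open>b\<close> is the quotient
  of two determinants with respect to a constant frame.\<close>

lemma continuous_on_sgn_volume:
  fixes A :: "('g::topological_space, 'a::euclidean_space) chart set"
  assumes A: "smooth_atlas A"
    and b: "\<And>x. x \<in> S \<Longrightarrow> frame (\<lambda>i. b i x)"
    and b_cont: "\<And>i. i < DIM('a) \<Longrightarrow> continuous_field A S (b i)"
    and X_cont: "\<And>i. i < DIM('a) \<Longrightarrow> continuous_field A S (X i)"
    and nz: "\<And>x. x \<in> S \<Longrightarrow> wedge_form DIM('a) (dual_basis (\<lambda>i. b i x)) (\<lambda>i. X i x) \<noteq> 0"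
  shows "continuous_on S (\<lambda>x. sgn (wedge_form DIM('a) (dual_basis (\<lambda>i. b i x)) (\<lambda>i. X i x)))"
proof -
  let ?\<delta> = "\<lambda>x. wedge_form DIM('a) (dual_basis (\<lambda>i. b i x)) (\<lambda>i. X i x)"
  obtain B :: "nat \<Rightarrow> 'a" where B: "frame B" using ex_frame by blast
  have local: "continuous_on (fst c \<inter> S) (\<lambda>x. sgn (?\<delta> x))" if c: "c \<in> A" for c
  proof -
    let ?D = "\<lambda>Y x. wedge_form DIM('a) (dual_basis B) (\<lambda>j. to_chart A c x (Y j x))"
    have D_cont: "continuous_on (fst c \<inter> S) (?D Y)"
      if "\<And>i. i < DIM('a) \<Longrightarrow> continuous_field A S (Y i)" for Y :: "nat \<Rightarrow> 'g \<Rightarrow> 'a"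
    proof (rule continuous_on_wedge_form)
      fix i j assume "j < DIM('a)"
      then have Y: "continuous_on (fst c \<inter> S) (\<lambda>x. to_chart A c x (Y j x))"
        using that c unfolding continuous_field_def by blast
      have "bounded_linear (dual_basis B i)"
        using dual_basis_linear[OF B] by (simp add: linear_conv_bounded_linear)
      then show "continuous_on (fst c \<inter> S) (\<lambda>x. dual_basis B i (to_chart A c x (Y j x)))"
        using Y by (rule bounded_linear.continuous_on)
    qed
    have L: "linear (to_chart A c x)" "inj (to_chart A c x)" if "x \<in> fst c" for x
      using to_chart_linear[OF A c that] to_chart_inj[OF A c that] by auto
    \<comment> \<open>Change of frame from \<open>b\<close>, applied to the constant covectors
      pulled back by \<open>to_chart\<close>.\<close>
    have quot: "?D X x = ?D b x * ?\<delta> x" if "x \<in> fst c \<inter> S" for x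
      using wedge_form_frame[OF b[of x], of "\<lambda>i. dual_basis B i \<circ> to_chart A c x" "\<lambda>i. X i x"]
        linear_compose[OF L(1) dual_basis_linear[OF B], of x] that
      by (simp add: wedge_form_def)
    have Db: "?D b x \<noteq> 0" if "x \<in> fst c \<inter> S" for x
    proof -
      have fr: "frame (\<lambda>i. to_chart A c x (b i x))"
        using frame_linear_image[OF b L] that by blast
      \<comment> \<open>Expanding \<open>B\<close> in the image of the frame \<open>b\<close>
        exhibits an inverse of the determinant in question.\<close>
      have "1 = wedge_form DIM('a) (dual_basis B) (\<lambda>i. to_chart A c x (b i x)) *
        wedge_form DIM('a) (dual_basis (\<lambda>i. to_chart A c x (b i x))) B"
        using wedge_form_frame[OF fr, of "dual_basis B" B] dual_basis_linear[OF B]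
        by (simp add: wedge_form_dual_basis_self[OF B])
      then show ?thesis by auto
    qed
    have "continuous_on (fst c \<inter> S) (\<lambda>x. sgn (?D X x / ?D b x))"
      using D_cont[of X] D_cont[of b] b_cont X_cont quot Db nz
      by (intro continuous_on_sgn continuous_on_divide) auto
    then show ?thesis
      by (rule continuous_on_eq) (use quot Db in simp)
  qed
  show ?thesis
    unfolding continuous_on_def
  proof
    fix x assume x: "x \<in> S"
    define c where "c = base_chart A x"
    have c: "c \<in> A" "x \<in> fst c" using base_chart[OF A] by (auto simp: c_def)
    \<comment> \<open>Chart domains are open, so continuity on each of them gives continuity on all
      of \<open>S\<close>.\<close>
    have "at x within S = at x within (fst c \<inter> S)"
      by (rule at_within_nhd[OF c(2) chart_open(1)[OF A c(1)]]) auto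
    then show "((\<lambda>x. sgn (?\<delta> x)) \<longlongrightarrow> sgn (?\<delta> x)) (at x within S)"
      using local[OF c(1)] c x by (simp add: continuous_on_def)
  qed
qed

text \<open>The measure sees only absolute values of forms; the choice of orientation is recorded by
  the sign \<open>s\<close>. Its continuity, wherever the normal frame is continuous, makes the sign
  locally constant on \<open>M\<close>.\<close>

theorem theorem2:
  fixes G :: "('g::{t2_space, second_countable_topology}, 'a::euclidean_space) stratified"
    and e f v :: "nat \<Rightarrow> 'g \<Rightarrow> 'a"
    and M U :: "'g set"
    and p :: nat
    and \<tau> :: "'g \<Rightarrow> nat set \<Rightarrow> real"
    and \<mu> :: "'g measure"
  assumes "stratified_group G"
    and "adapted_basis G e"
    and "submanifold (atlas G) p M"
    and "non_horizontal G M"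
    and "\<And>x. x \<in> M \<Longrightarrow> unit_tangent_mv G e (DIM('a) - p) M x (\<tau> x)"
    and "\<And>x. x \<in> M \<Longrightarrow> normal_frame_at G p M v x"
    and "sets \<mu> = sets (restrict_space borel M)"
    and "has_form_density (atlas G) p M UNIV \<mu>
           (\<lambda>x w. mv_norm DIM('a) (degree_part G e (hausdorff_dim G - p) (\<tau> x))
                    * induced_volume e p v x w)"
    and "adapted_frame G e p M U f"
  shows "has_form_density (atlas G) p M U \<mu>
           (\<lambda>x. wedge_form (DIM('a) - p) (\<lambda>i. dual_basis (\<lambda>j. f j x) (p + i))) \<and>
         (\<exists>s :: 'g \<Rightarrow> real.
           (\<forall>x \<in> M \<inter> U. s x \<in> {-1, 1} \<and>
              (\<forall>w. (\<forall>i < DIM('a) - p. w i \<in> tangent_space (atlas G) M x) \<longrightarrow>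
                 mv_norm DIM('a) (degree_part G e (hausdorff_dim G - p) (\<tau> x))
                     * induced_volume e p v x w
                   = s x * wedge_form (DIM('a) - p) (\<lambda>i. dual_basis (\<lambda>j. f j x) (p + i)) w)) \<and>
           (\<forall>W. open W \<and> W \<subseteq> U \<and> (\<forall>i<p. continuous_field (atlas G) (M \<inter> W) (v i)) \<longrightarrow>
                continuous_on (M \<inter> W) s))"
proof -
  interpret stratified_basis G e
    by unfold_locales fact+
  let ?A = "atlas G" and ?q = "layer_dim G 1"
  let ?T = "\<lambda>x. tangent_space ?A M x"
  let ?E = "\<lambda>x i. e i x" and ?F = "\<lambda>x i. f i x"
  let ?c = "\<lambda>x. mv_norm DIM('a) (degree_part G e (hausdorff_dim G - p) (\<tau> x))"
  let ?\<omega> = "\<lambda>x. wedge_form (DIM('a) - p) (\<lambda>i. dual_basis (?F x) (p + i))"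
  let ?P = "\<lambda>i x. if i < p then v i x else f i x"
  let ?\<delta> = "\<lambda>x. wedge_form DIM('a) (dual_basis (?E x)) (\<lambda>i. ?P i x)"
  \<comment> \<open>The orientation of the mixed frame, the normal \<open>v\<close> followed by the
    tangent part of \<open>f\<close>, relative to \<open>e\<close>.\<close>
  define s where "s x = sgn (?\<delta> x)" for x
  have atlas: "smooth_atlas ?A"
    using assms(1) by (simp add: stratified_group_def lie_group_def)
  note af = assms(9)[unfolded adapted_frame_def]
  from af obtain x0 where x0: "x0 \<in> M" "x0 \<in> U" by blast
  have p: "p \<le> DIM('a)"
    using assms(3) x0(1) unfolding submanifold_def slice_chart_def by (metis le_add1)
  have frame_F: "frame (?F x)" if "x \<in> U" for x
    using af that by (simp add: frame_def)
  have span_hor: "span (?F x ` {..<?q}) = horizontal G x" if "x \<in> U" for x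
    using af that by blast
  have span_normal: "span (?F x ` {..<p}) = horizontal_normal G M x"
    and span_tangent: "span (?F x ` {p..<?q}) = ?T x \<inter> horizontal G x" if "x \<in> M \<inter> U" for x
    using af that by blast+
  have F_orth: "riem G x (f i x) (f j x) = (if i = j then 1 else 0)"
    if "x \<in> U" "i < ?q" "j < ?q" for x i j
    using af that by blast
  obtain a :: "nat \<Rightarrow> nat \<Rightarrow> 'g \<Rightarrow> real" where
    a: "f j x = e j x - (\<Sum>\<alpha><p. a j \<alpha> x *\<^sub>R f \<alpha> x)" "f j x \<in> ?T x"
    if "x \<in> M \<inter> U" "j \<in> {?q..<DIM('a)}" for x j
    using af by metis
  have F_hor: "f j x \<in> horizontal G x" if "x \<in> U" "j < ?q" for x j
    using span_hor[OF that(1)] span_base[of "f j x" "?F x ` {..<?q}"] that(2) by blast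
  \<comment> \<open>Otherwise \<open>f ?q\<close> would be among the first \<open>p\<close> vectors,
    which span horizontal normals, and hence would lie in the span of its predecessors.\<close>
  have pq: "p \<le> ?q"
  proof (rule ccontr)
    assume "\<not> p \<le> ?q"
    then have q: "?q < p" "?q < DIM('a)" using p by auto
    have "f ?q x0 \<in> span (?F x0 ` {..<p})" using q(1) by (intro span_base) auto
    then have "f ?q x0 \<in> span (?F x0 ` {..<?q})"
      using span_normal[of x0] span_hor[OF x0(2)] x0 by (auto simp: horizontal_normal_def)
    then obtain c where c: "f ?q x0 = (\<Sum>i<?q. c i *\<^sub>R f i x0)"
      unfolding real_vector.span_family[OF finite_lessThan] by blast
    note lin = dual_basis_linear[OF frame_F[OF x0(2)]]
    have "dual_basis (?F x0) ?q (\<Sum>i<?q. c i *\<^sub>R f i x0) = 0"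
      unfolding linear_sum[OF lin] linear_scale[OF lin]
      using q(2) by (intro sum.neutral) (simp add: dual_basis_basis[OF frame_F[OF x0(2)]])
    then show False
      using dual_basis_basis[OF frame_F[OF x0(2)], of ?q ?q] q(2) unfolding c[symmetric] by simp
  qed
  have data: "adapted_data (?E x) (?F x) (\<lambda>i. v i x) p ?q (?T x) (riem G x)" if x: "x \<in> M \<inter> U" for x
  proof
    have xU: "x \<in> U" using x by blast
    note lin = dual_basis_linear[OF frame_e[of x]]
    have V: "span ((\<lambda>i. v i x) ` {..<p}) = riem_normal G M x"
      "\<And>i j. i < p \<Longrightarrow> j < p \<Longrightarrow> riem G x (v i x) (v j x) = (if i = j then 1 else 0)"
      using assms(6)[of x] x by (auto simp: normal_frame_at_def)
    show "frame (?E x)" by (rule frame_e)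
    show "frame (?F x)" by (rule frame_F[OF xU])
    show "p \<le> ?q" by (rule pq)
    show "?q \<le> DIM('a)" by (rule layer_dim_1_le)
    show "riem G x \<xi> \<eta> = (\<Sum>k<DIM('a). dual_basis (?E x) k \<xi> * dual_basis (?E x) k \<eta>)" for \<xi> \<eta>
      by (rule riem_eq)
    show "dual_basis (?E x) k (f j x) = 0" if "j < ?q" "?q \<le> k" "k < DIM('a)" for j k
      by (rule dual_basis_horizontal[OF F_hor[OF xU that(1)] that(2,3)])
    show "riem G x (f i x) (f j x) = (if i = j then 1 else 0)" if "i < ?q" "j < ?q" for i j
      by (rule F_orth[OF xU that])
    show "dual_basis (?E x) k (f j x) = (if k = j then 1 else 0)"
      if "?q \<le> j" "j < DIM('a)" "?q \<le> k" "k < DIM('a)" for j k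
    proof -
      have zero: "dual_basis (?E x) k (f \<alpha> x) = 0" if "\<alpha> < p" for \<alpha>
        using dual_basis_horizontal[OF F_hor[OF xU, of \<alpha>] \<open>?q \<le> k\<close> \<open>k < DIM('a)\<close>] that pq by simp
      \<comment> \<open>The correction terms in \<open>f j\<close> are horizontal, so its vertical
        coordinates are those of \<open>e j\<close>.\<close>
      have "dual_basis (?E x) k (f j x) = dual_basis (?E x) k (e j x)"
        unfolding a(1)[OF x, of j, unfolded atLeastLessThan_iff, OF conjI[OF that(1,2)]]
          linear_diff[OF lin] linear_sum[OF lin] linear_scale[OF lin]
        by (simp add: zero)
      then show ?thesis using that by (simp add: dual_basis_basis[OF frame_e])
    qed
    show "f j x \<in> ?T x" if "p \<le> j" "j < DIM('a)" for j
    proof (cases "j < ?q")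
      case True
      then have "f j x \<in> span (?F x ` {p..<?q})" using that by (intro span_base) auto
      then show ?thesis using span_tangent[OF x] by blast
    next
      case False
      then show ?thesis using a(2)[OF x, of j] that by simp
    qed
    show "riem G x (v i x) (v j x) = (if i = j then 1 else 0)" if "i < p" "j < p" for i j
      by (rule V(2)[OF that])
    show "riem G x (v i x) w = 0" if "i < p" "w \<in> ?T x" for i w
    proof -
      have "v i x \<in> riem_normal G M x"
        unfolding V(1)[symmetric] using that(1) by (intro span_base) auto
      then show ?thesis using that(2) by (simp add: riem_normal_def)
    qed
  qed
  have P: "adapted_data.P (?F x) (\<lambda>i. v i x) p = (\<lambda>i. ?P i x)" if "x \<in> M \<inter> U" for x
    using adapted_data.P_def[OF data[OF that]] by auto
  \<comment> \<open>The degree criterion supplies the predicate \<open>D\<close> of the pointwise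
    computation. In particular \<open>?\<delta> x\<close> is nonzero, and \<open>?c x\<close> times
    it is its sign.\<close>
  have abs1: "?c x * \<bar>?\<delta> x\<bar> = 1" if x: "x \<in> M \<inter> U" for x
  proof -
    obtain w where w: "\<And>i. i < DIM('a) - p \<Longrightarrow> w i \<in> ?T x"
        "\<tau> x = wedge_vec (DIM('a) - p) (?E x) w" "mv_norm DIM('a) (\<tau> x) = 1"
      using assms(5)[of x] x unfolding unit_tangent_mv_def by blast
    have part: "degree_part G e (hausdorff_dim G - p) (\<tau> x) =
      (\<lambda>K. if (\<Sum>i\<in>K. field_degree G (e i)) = hausdorff_dim G - p then \<tau> x K else 0)"
      by (simp add: degree_part_def fun_eq_iff)
    show ?thesis
      unfolding part P[OF x, symmetric]
      by (rule adapted_data.density_volume[OF data[OF x] w(1) w(2,3) degree_eq_iff[OF p]])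
  qed
  have vol: "induced_volume e p v x w = ?\<delta> x * ?\<omega> x w"
    if x: "x \<in> M \<inter> U" and w: "\<And>i. i < DIM('a) - p \<Longrightarrow> w i \<in> ?T x" for x w
    unfolding induced_volume_def P[OF x, symmetric]
    by (rule adapted_data.volume_tangent[OF data[OF x], of w, OF w])
  have s1: "s x \<in> {-1, 1}" and cs: "?c x * ?\<delta> x = s x" if x: "x \<in> M \<inter> U" for x
  proof -
    have "?\<delta> x \<noteq> 0" using abs1[OF x] by auto
    then show "s x \<in> {-1, 1}" by (auto simp: s_def sgn_if)
    show "?c x * ?\<delta> x = s x"
      using abs1[OF x] by (auto simp: s_def sgn_if abs_if split: if_splits)
  qed
  have eq: "?c x * induced_volume e p v x w = s x * ?\<omega> x w"
    if "x \<in> M \<inter> U" "\<And>i. i < DIM('a) - p \<Longrightarrow> w i \<in> ?T x" for x w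
  proof -
    have "induced_volume e p v x w = ?\<delta> x * ?\<omega> x w"
      by (rule vol[OF that(1)]) (rule that(2))
    then show ?thesis
      unfolding cs[OF that(1), symmetric] by (simp only: mult.assoc)
  qed
  have "has_form_density ?A p M U \<mu> ?\<omega>"
  proof (rule has_form_density_cong[OF atlas assms(7)])
    show "has_form_density ?A p M U \<mu> (\<lambda>x w. ?c x * induced_volume e p v x w)"
      by (rule has_form_density_mono[OF assms(8)]) simp
    show "\<bar>?c x * induced_volume e p v x w\<bar> = \<bar>?\<omega> x w\<bar>"
      if "x \<in> M \<inter> U" "\<And>i. i < DIM('a) - p \<Longrightarrow> w i \<in> ?T x" for x w
    proof -
      have "?c x * induced_volume e p v x w = s x * ?\<omega> x w"
        by (rule eq[OF that(1)]) (rule that(2))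
      then show ?thesis using s1[OF that(1)] by (auto simp: abs_mult)
    qed
  qed
  \<comment> \<open>Among the fields entering the determinant, \<open>e\<close> and \<open>f\<close>
    are smooth; the continuity of \<open>v\<close> is the condition imposed on
    \<open>W\<close>.\<close>
  moreover have "continuous_on (M \<inter> W) s"
    if W: "W \<subseteq> U" and v: "\<forall>i<p. continuous_field ?A (M \<inter> W) (v i)" for W
    unfolding s_def
  proof (rule continuous_on_sgn_volume[OF atlas])
    have restrict: "continuous_field ?A (M \<inter> W) X" if "smooth_field ?A V X" "W \<subseteq> V" for X V
      unfolding continuous_field_def
    proof
      fix c assume "c \<in> ?A"
      from smooth_field_continuous_field[OF atlas that(1) this]
      show "continuous_on (fst c \<inter> (M \<inter> W)) (\<lambda>x. to_chart ?A c x (X x))"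
        by (rule continuous_on_subset) (use that(2) in blast)
    qed
    show "frame (?E x)" for x by (rule frame_e)
    show "continuous_field ?A (M \<inter> W) (e i)" if "i < DIM('a)" for i
      by (rule restrict[where V = UNIV]) (use e_lie_alg[OF that] in \<open>auto simp: lie_alg_def\<close>)
    show "continuous_field ?A (M \<inter> W) (?P i)" if "i < DIM('a)" for i
    proof (cases "i < p")
      case True
      then show ?thesis using v by simp
    next
      case False
      have "continuous_field ?A (M \<inter> W) (f i)"
        by (rule restrict[OF _ W]) (use af that in blast)
      then show ?thesis using False by simp
    qed
    show "?\<delta> x \<noteq> 0" if "x \<in> M \<inter> W" for x
      using abs1[of x] that W by auto
  qed
  ultimately show ?thesis
    using s1 eq by blast
qed

end
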